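(* Let $f_0\in\mathcal F^\beta(L)$ for some $\beta>0$ and $L\ge1$, and let $X=X^{(n)}\sim P_{f_0}^{(n)}$ be generated from the Gaussian sequence model. Let $(\sigma_k)_{k\ge1}$ be a positive sequence and $(p_k)_{k\ge1}$ a sequence with $0<p_k\le1$ for all $k\ge 1$. Let $\Pi$ be the prior on $f=(f_k)_{k\ge1}$ under which $f_k=\sigma_k\zeta_k$, with $(\zeta_k)$ independent and $\zeta_k$ having density $h_{p_k}$, where $h_p(t)\propto\exp(-|t|^p/p)$, $t\in\mathbb R$. Set $$r_k=\frac{k^{-\beta-1/2}}{\sigma_k},\qquad z_k=\frac{r_k^{p_k}}{p_k},\qquad N_\beta=\lfloor n^{\frac1{2\beta+1}}\rfloor .$$ Assume that, for $n$ large enough, $r_k^{p_k}\ge8$ for all $k>N_\beta$. Assume furthermore that there exists a constant $\eta>1$ such that $$\sum_{k\ge1}\exp\{-z_k/4\}<+\infty\qquad\text{and}\qquad \sum_{k\le N_\beta}z_k\lesssim N_\beta\log^\eta n .$$ Then for any $\rho\in(0,1)$ there exists a constant $\eta'>2\eta$ such that, as $n\to\infty$, $$E_{f_0}\Pi_\rho\big[\,\|f-f_0\|_2\le n^{-\frac{\beta}{2\beta+1}}\log^{\eta'}n\,\big|\,X\big]\to1 .$$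
   Context: Gaussian sequence model: functions $f\in L^2[0,1]$ are identified with their coefficient sequences $(f_k)_{k\ge1}$ in a fixed orthonormal basis of $L^2[0,1]$, so $\|f\|_2^2=\sum_k f_k^2$. For $n\ge1$, $P_f^{(n)}$ is the law of $X=(X_k)_{k\ge1}$ with $X_k=f_k+n^{-1/2}\xi_k$, $\xi_k$ i.i.d. $\mathcal N(0,1)$. $E_{f_0}$ is expectation under $P_{f_0}^{(n)}$. $\rho$-posterior: for a prior $\Pi$ and $\rho\in(0,1]$, $\Pi_\rho[B\mid X]=\int_B e^{\rho\ell_n(f,X)}d\Pi(f)\big/\int e^{\rho\ell_n(f,X)}d\Pi(f)$, where $\ell_n(f,X)=-\frac n2\sum_k(X_k-f_k)^2$, understood up to an additive term not depending on $f$, i.e. as $n\sum_k X_kf_k-\frac n2\sum_k f_k^2$ (log-density with respect to $P_0^{(n)}$). Hyperrectangle: $\mathcal F^\beta(L)=\{f=(f_k):\ \max_{k\ge1}|f_k|k^{\beta+1/2}\le L\}$. $a_n\lesssim b_n$ means $a_n\le Cb_n$ for a constant $C>0$ independent of $n$ (for $n$ large). *)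

theory Defs
  imports "HOL-Probability.Probability" "HOL-Library.Landau_Symbols"
begin

text \<open>
  Coefficient sequences have type \<^typ>\<open>nat \<Rightarrow> real\<close> and index set \<open>{1..}\<close>; the value at
  \<open>0\<close> is never used. Laws on sequences live on the product sigma-algebra below, and the series
  over \<open>k \<ge> 1\<close> are written as \<open>\<Sum>k. a (Suc k)\<close>.
\<close>

abbreviation seq_space :: "(nat \<Rightarrow> real) measure" where
  "seq_space \<equiv> Pi\<^sub>M {1..} (\<lambda>_. borel)"

definition l2_seq :: "(nat \<Rightarrow> real) \<Rightarrow> bool" where
  "l2_seq f \<longleftrightarrow> summable (\<lambda>k. (f (Suc k))\<^sup>2)"

definition l2_norm :: "(nat \<Rightarrow> real) \<Rightarrow> real" where
  "l2_norm f = sqrt (\<Sum>k. (f (Suc k))\<^sup>2)"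

text \<open>The membership condition is needed because \<^const>\<open>suminf\<close> is unspecified on divergent series.\<close>

definition l2_cball :: "(nat \<Rightarrow> real) \<Rightarrow> real \<Rightarrow> (nat \<Rightarrow> real) set" where
  "l2_cball g e = {f. l2_seq (\<lambda>k. f k - g k) \<and> l2_norm (\<lambda>k. f k - g k) \<le> e}"

definition hyperrectangle :: "real \<Rightarrow> real \<Rightarrow> (nat \<Rightarrow> real) set" where
  "hyperrectangle \<beta> L = {f. \<forall>k\<ge>1. \<bar>f k\<bar> * real k powr (\<beta> + 1/2) \<le> L}"

definition gauss_seq_model :: "nat \<Rightarrow> (nat \<Rightarrow> real) \<Rightarrow> (nat \<Rightarrow> real) measure" where
  "gauss_seq_model n f =
     distr (Pi\<^sub>M {1..} (\<lambda>_. std_normal_distribution)) seq_space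
       (\<lambda>\<xi>. \<lambda>k\<in>{1..}. f k + \<xi> k / sqrt (real n))"

definition exp_power_density :: "real \<Rightarrow> real \<Rightarrow> real" where
  "exp_power_density p t =
     exp (- (\<bar>t\<bar> powr p) / p) / (\<integral>s. exp (- (\<bar>s\<bar> powr p) / p) \<partial>lborel)"

definition exp_power_prior :: "(nat \<Rightarrow> real) \<Rightarrow> (nat \<Rightarrow> real) \<Rightarrow> (nat \<Rightarrow> real) measure" where
  "exp_power_prior \<sigma> p =
     distr (Pi\<^sub>M {1..} (\<lambda>k. density lborel (\<lambda>t. ennreal (exp_power_density (p k) t)))) seq_space
       (\<lambda>\<zeta>. \<lambda>k\<in>{1..}. \<sigma> k * \<zeta> k)"

text \<open>
  Log-density with respect to the model at \<open>f = 0\<close>. The sequence \<open>X\<close> is not square summable, so the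
  first series is a limit of partial sums; for each square summable \<open>f\<close> it converges for almost
  every \<open>X\<close> drawn from the model at any square summable parameter.
\<close>

definition log_lik :: "nat \<Rightarrow> (nat \<Rightarrow> real) \<Rightarrow> (nat \<Rightarrow> real) \<Rightarrow> real" where
  "log_lik n f X =
     real n * (\<Sum>k. X (Suc k) * f (Suc k)) - real n / 2 * (\<Sum>k. (f (Suc k))\<^sup>2)"

definition rho_posterior ::
    "real \<Rightarrow> nat \<Rightarrow> (nat \<Rightarrow> real) measure \<Rightarrow> (nat \<Rightarrow> real) \<Rightarrow> (nat \<Rightarrow> real) set \<Rightarrow> real" where
  "rho_posterior \<rho> n Q X B =
     (LINT f:B|Q. exp (\<rho> * log_lik n f X)) / (LINT f|Q. exp (\<rho> * log_lik n f X))"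

definition ratio_seq :: "real \<Rightarrow> (nat \<Rightarrow> real) \<Rightarrow> nat \<Rightarrow> real" where
  "ratio_seq \<beta> \<sigma> k = real k powr (- \<beta> - 1/2) / \<sigma> k"

definition z_seq :: "real \<Rightarrow> (nat \<Rightarrow> real) \<Rightarrow> (nat \<Rightarrow> real) \<Rightarrow> nat \<Rightarrow> real" where
  "z_seq \<beta> \<sigma> p k = ratio_seq \<beta> \<sigma> k powr p k / p k"

definition cutoff :: "real \<Rightarrow> nat \<Rightarrow> nat" where
  "cutoff \<beta> n = nat \<lfloor>real n powr (1 / (2 * \<beta> + 1))\<rfloor>"

end

theory Submission
  imports Defs "HOL-Real_Asymp.Real_Asymp"
begin

text \<open>
  Write \<open>W\<^sub>s(f) = exp (s (l(f) - l(f0)))\<close> for the powers of the likelihood ratio. Under the law at \<open>f0\<close>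
  its expectation is at most \<open>exp (- s (1 - s) n |f - f0|^2 / 2)\<close>. With \<open>s = \<rho>\<close> this makes the
  unnormalised posterior mass of \<open>{|f - f0| > e}\<close> at most \<open>exp (- c n e^2)\<close> in mean; with \<open>s = -\<rho>\<close> it
  controls the reciprocal of the normalising constant by the prior mass of a neighbourhood \<open>K\<close> of
  \<open>f0\<close>. For \<open>K\<close> take \<open>|f k - f0 k| \<le> N^(-\<beta>-1/2)\<close> if \<open>k \<le> N\<close> and \<open>|f k| \<le> k^(-\<beta>-1/2)\<close> if \<open>k > N\<close>, with
  \<open>N\<close> the cutoff. Frequencies \<open>k > N\<close> cost only a constant factor, since the prior gives
  \<open>|f k| > k^(-\<beta>-1/2)\<close> probability of order \<open>exp (- z k / 4)\<close>; frequencies \<open>k \<le> N\<close> cost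
  \<open>exp (- C (log N + z k))\<close> each. So \<open>K\<close> has prior mass at least \<open>exp (- C N log^\<eta> n)\<close>, which is
  negligible against \<open>n e^2\<close> as soon as \<open>2 \<eta>' > \<eta>\<close>.
\<close>

section \<open>Gaussian noise and likelihood ratios\<close>

text \<open>The inner product with \<open>X\<close> in \<open>log_lik\<close> is a limit of partial
  sums whose exceptional null set depends on \<open>f\<close>, so convergence cannot be claimed for
  all \<open>f\<close> at once. The proof therefore works with sequences that decay like
  \<open>k powr (- \<beta> - 1/2)\<close>. This class contains \<open>f0\<close>, the box and, by
  Borel-Cantelli, prior almost every \<open>f\<close>; for each fixed member the series converges
  for almost every \<open>X\<close>, and Tonelli makes that sufficient. The moment bounds then come
  from Fatou as inequalities, in the direction that is needed. No tests or entropy bounds occur: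
  \<open>s * (1 - s)\<close> is positive at \<open>s = \<rho>\<close> because
  \<open>\<rho> < 1\<close>, so the expected fractional likelihood ratio is itself small away from
  \<open>f0\<close>. The shape parameters \<open>p k\<close> may approach 0, so the bounds for one
  coordinate must be uniform in \<open>p\<close>. In the tail bound a quarter of \<open>z k\<close>
  stays visible; the other three quarters, with \<open>r powr p \<ge> 8\<close>, pay for
  integrability and for the normalising constant, which is only bounded below by
  \<open>2 * exp (- 1 / p)\<close>.\<close>

abbreviation gauss_noise :: "(nat \<Rightarrow> real) measure" where
  "gauss_noise \<equiv> Pi\<^sub>M {1..} (\<lambda>_. std_normal_distribution)"

lemma nn_integral_exp_std_normal:
  "(\<integral>\<^sup>+x. ennreal (exp (a * x)) \<partial>std_normal_distribution) = ennreal (exp (a\<^sup>2 / 2))"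
proof -
  have "(\<integral>\<^sup>+x. ennreal (exp (a * x)) \<partial>std_normal_distribution)
      = (\<integral>\<^sup>+x. ennreal (exp (a\<^sup>2 / 2)) * ennreal (normal_density a 1 x) \<partial>lborel)"
    
  proof (subst nn_integral_density; (simp; fail)?; intro nn_integral_cong)
    fix x :: real
    have "std_normal_density x * exp (a * x) = exp (a\<^sup>2 / 2) * normal_density a 1 x"
      unfolding normal_density_def
      by (simp add: exp_add[symmetric] field_simps power2_eq_square)
    thus "ennreal (std_normal_density x) * ennreal (exp (a * x))
        = ennreal (exp (a\<^sup>2 / 2)) * ennreal (normal_density a 1 x)"
      by (simp add: ennreal_mult'[symmetric])
  qed
  also have "\<dots> = ennreal (exp (a\<^sup>2 / 2)) * (\<integral>\<^sup>+x. ennreal (normal_density a 1 x) \<partial>lborel)"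
    by (rule nn_integral_cmult) simp
  also have "(\<integral>\<^sup>+x. ennreal (normal_density a 1 x) \<partial>lborel) = 1"
    by (subst nn_integral_eq_integral) (auto simp: integral_normal_density)
  finally show ?thesis by simp
qed

lemma sets_gauss_noise [measurable_cong]: "sets gauss_noise = sets seq_space"
  by (rule sets_PiM_cong) auto

lemma prob_space_gauss_noise: "prob_space gauss_noise"
  by (intro prob_space_PiM prob_space_normal_density[of 1 0]) auto

lemma nn_integral_exp_gauss_sum:
  assumes "finite J" "J \<subseteq> {1..}"
  shows "(\<integral>\<^sup>+\<xi>. ennreal (exp (\<Sum>k\<in>J. a k * \<xi> k)) \<partial>gauss_noise)
       = ennreal (exp ((\<Sum>k\<in>J. (a k)\<^sup>2) / 2))"
proof -
  interpret N: prob_space std_normal_distribution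
    by (rule prob_space_normal_density) simp
  interpret product_prob_space "\<lambda>_. std_normal_distribution" "{1::nat..}"
    by unfold_locales
  have [measurable_cong]: "sets std_normal_distribution = sets borel"
    by simp
  let ?g = "\<lambda>\<xi>. ennreal (exp (\<Sum>k\<in>J. a k * \<xi> k))"
  have "(\<integral>\<^sup>+\<xi>. ?g \<xi> \<partial>gauss_noise) = (\<integral>\<^sup>+\<xi>. ?g (restrict \<xi> J) \<partial>gauss_noise)"
    by (intro nn_integral_cong arg_cong[of _ _ ennreal] arg_cong[of _ _ exp] sum.cong) auto
  also have "\<dots> = (\<integral>\<^sup>+\<xi>. ?g \<xi> \<partial>(distr gauss_noise (Pi\<^sub>M J (\<lambda>_. std_normal_distribution)) (\<lambda>\<xi>. restrict \<xi> J)))"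
    using assms by (intro nn_integral_distr[symmetric] measurable_restrict_subset) (auto simp: measurable_distr_eq1)
  also have "\<dots> = (\<integral>\<^sup>+\<xi>. (\<Prod>k\<in>J. ennreal (exp (a k * \<xi> k))) \<partial>(Pi\<^sub>M J (\<lambda>_. std_normal_distribution)))"
    unfolding distr_PiM_restrict_finite[OF assms] using assms by (simp add: exp_sum prod_ennreal)
  also have "\<dots> = (\<Prod>k\<in>J. \<integral>\<^sup>+x. ennreal (exp (a k * x)) \<partial>std_normal_distribution)"
    using assms by (intro product_nn_integral_prod) auto
  also have "\<dots> = ennreal (exp ((\<Sum>k\<in>J. (a k)\<^sup>2) / 2))"
    using assms by (simp add: nn_integral_exp_std_normal prod_ennreal exp_sum sum_divide_distrib)
  finally show ?thesis .
qed


section \<open>Almost sure convergence of Gaussian series and their exponential moments\<close>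

text \<open>Telescoping gives a limit along the powers of two; the oscillation within a block tends
  to 0 and carries this limit to the indices in between.\<close>

lemma convergent_if_dyadic_oscillation_summable:
  fixes S :: "nat \<Rightarrow> real"
  assumes \<delta>: "summable \<delta>"
    and osc: "\<forall>\<^sub>F m in sequentially. \<forall>j\<in>{2^m<..2^Suc m}. \<bar>S j - S (2^m)\<bar> \<le> \<delta> m"
  shows "convergent S"
proof -
  have "\<forall>\<^sub>F m in sequentially. norm (S (2^Suc m) - S (2^m)) \<le> \<delta> m"
    using osc by eventually_elim auto
  hence "summable (\<lambda>m. S (2^Suc m) - S (2^m))"
    by (rule summable_comparison_test_ev) fact
  hence "(\<lambda>n. \<Sum>m<n. S (2^Suc m) - S (2^m)) \<longlonglongrightarrow> (\<Sum>m. S (2^Suc m) - S (2^m))"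
    by (rule summable_LIMSEQ)
  moreover have "(\<Sum>m<n. S (2^Suc m) - S (2^m)) = S (2^n) - S 1" for n
    by (induction n) auto
  ultimately have "(\<lambda>n. S (2^n) - S 1) \<longlonglongrightarrow> (\<Sum>m. S (2^Suc m) - S (2^m))" by simp
  from tendsto_add[OF this tendsto_const[of "S 1"]]
  obtain s where s: "(\<lambda>n. S (2^n)) \<longlonglongrightarrow> s" by auto
  have "S \<longlonglongrightarrow> s"
  proof (rule LIMSEQ_I)
    fix e :: real assume e: "0 < e"
    have "\<forall>\<^sub>F m in sequentially. \<delta> m < e/2"
      using e by (intro order_tendstoD(2)[OF summable_LIMSEQ_zero[OF \<delta>]]) auto
    moreover have "\<forall>\<^sub>F m in sequentially. dist (S (2^m)) s < e/2"
      using e by (intro tendstoD[OF s]) auto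
    ultimately have "\<forall>\<^sub>F m in sequentially. \<forall>j\<in>{2^m<..2^Suc m}. \<bar>S j - s\<bar> < e"
      using osc
    proof eventually_elim
      case (elim m)
      show ?case
      proof
        fix j :: nat assume "j \<in> {2^m<..2^Suc m}"
        with elim have "\<bar>S j - S (2^m)\<bar> < e/2" by force
        with elim(2) show "\<bar>S j - s\<bar> < e" unfolding dist_real_def by linarith
      qed
    qed
    then obtain M where M: "\<And>m j. m \<ge> M \<Longrightarrow> j \<in> {2^m<..2^Suc m} \<Longrightarrow> \<bar>S j - s\<bar> < e"
      unfolding eventually_sequentially by blast
    show "\<exists>N. \<forall>j\<ge>N. norm (S j - s) < e"
    proof (intro exI allI impI)
      \<comment> \<open>The blocks are open on the left: the index \<open>2^M\<close> itself still
        belongs to block \<open>M - 1\<close>, hence the \<open>+ 1\<close>.\<close>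
      fix j :: nat assume j: "j \<ge> 2^M + 1"
      hence "j \<ge> 2" by (smt (verit) one_le_power add_le_imp_le_right nat_1_add_1 order_trans one_le_numeral add_mono order_refl)
      then obtain m where m: "2^m < j" "j \<le> 2^(m+1)" using ex_power_ivl2[of 2 j] by auto
      have "(2::nat)^M < 2^(m+1)" using j m by linarith
      hence "M < m + 1" by (rule power_less_imp_less_exp[rotated]) simp
      thus "norm (S j - s) < e" using M[of m j] m by simp
    qed
  qed
  thus ?thesis by (rule convergentI)
qed

text \<open>Decay at the rate of the hyperrectangle with an unspecified constant, so that the class
  is linear. It is stronger than square summability: the part of a Gaussian series in the
  \<open>m\<close>-th dyadic block has variance of order \<open>2 powr (- 2 * b * m)\<close>, and
  this geometric rate replaces a maximal inequality.\<close>

definition poly_decay :: "real \<Rightarrow> (nat \<Rightarrow> real) \<Rightarrow> bool" where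
  "poly_decay b a \<longleftrightarrow> (\<exists>C. \<forall>k\<ge>1. \<bar>a k\<bar> \<le> C * real k powr (-b-1/2))"

lemma poly_decay_cmult: "poly_decay b a \<Longrightarrow> poly_decay b (\<lambda>k. c * a k)"
  unfolding poly_decay_def
proof (elim exE)
  fix C assume "\<forall>k\<ge>1. \<bar>a k\<bar> \<le> C * real k powr (-b-1/2)"
  thus "\<exists>C. \<forall>k\<ge>1. \<bar>c * a k\<bar> \<le> C * real k powr (-b-1/2)"
    by (intro exI[of _ "\<bar>c\<bar> * C"]) (simp add: abs_mult mult.assoc mult_left_mono)
qed

lemma poly_decay_diff:
  assumes "poly_decay b a" "poly_decay b a'"
  shows "poly_decay b (\<lambda>k. a k - a' k)"
proof -
  from assms obtain C C' where
    "\<forall>k\<ge>1. \<bar>a k\<bar> \<le> C * real k powr (-b-1/2)" "\<forall>k\<ge>1. \<bar>a' k\<bar> \<le> C' * real k powr (-b-1/2)"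
    unfolding poly_decay_def by blast
  hence "\<bar>a k - a' k\<bar> \<le> (C + C') * real k powr (-b-1/2)" if "k \<ge> 1" for k
    using that abs_triangle_ineq4[of "a k" "a' k"] by (fastforce simp: distrib_right)
  thus ?thesis unfolding poly_decay_def by blast
qed

lemma poly_decay_summable_mult:
  assumes "b > 0" "poly_decay b a" "poly_decay b a'"
  shows "summable (\<lambda>k. a (Suc k) * a' (Suc k))"
proof -
  from assms obtain C C' where
    C: "\<And>k. k\<ge>1 \<Longrightarrow> \<bar>a k\<bar> \<le> C * real k powr (-b-1/2)" 
    "\<And>k. k\<ge>1 \<Longrightarrow> \<bar>a' k\<bar> \<le> C' * real k powr (-b-1/2)"
    unfolding poly_decay_def by blast
  show ?thesis
  proof (rule summable_comparison_test', rule summable_mult[where c = "C * C'"])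
    show "summable (\<lambda>k. real (Suc k) powr (-2*b-1))"
      using \<open>b > 0\<close> by (subst summable_Suc_iff) (simp add: summable_real_powr_iff)
    fix k :: nat
    have "norm (a (Suc k) * a' (Suc k)) = \<bar>a (Suc k)\<bar> * \<bar>a' (Suc k)\<bar>" by (simp add: abs_mult)
    also have "\<dots> \<le> (C * real (Suc k) powr (-b-1/2)) * (C' * real (Suc k) powr (-b-1/2))"
      by (rule mult_mono[OF C]) (use order_trans[OF abs_ge_zero C(1)[of "Suc k"]] in auto)
    also have "\<dots> = C * C' * real (Suc k) powr (-2*b-1)"
      by (simp add: powr_add[symmetric])
    finally show "norm (a (Suc k) * a' (Suc k)) \<le> C * C' * real (Suc k) powr (-2*b-1)" .
  qed
qed

lemma sum_Suc_shift: "(\<Sum>k<m. g (Suc k)) = (\<Sum>k=1..m. g k)" for g :: "nat \<Rightarrow> real"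
  by (rule sum.reindex_bij_witness[of _ "\<lambda>k. k - 1" Suc]) auto

text \<open>Under polynomial decay, the expected exponential moments of the oscillations over dyadic blocks,
  weighted by \<open>4^(-m)\<close>, are summable; no maximal inequality is needed.\<close>

lemma AE_summable_gauss_series:
  assumes b: "b > 0" and "poly_decay b a"
  shows "AE \<xi> in gauss_noise. summable (\<lambda>k. a (Suc k) * \<xi> (Suc k))"
proof -
  from assms obtain C where C: "\<And>k. k\<ge>1 \<Longrightarrow> \<bar>a k\<bar> \<le> C * real k powr (-b-1/2)"
    unfolding poly_decay_def by blast
  define S where "S \<xi> j = (\<Sum>k=1..j. a k * \<xi> k)" for \<xi> j
  \<comment> \<open>Up to the constant \<open>C\<close>, the inverse of the standard deviation of a
    block: the increments multiplied by \<open>lam m\<close> have variance at most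
    \<open>C\<^sup>2\<close>, so their exponential moments are bounded independently of
    \<open>m\<close>.\<close>
  define lam where "lam m = ((2::real)^m) powr b" for m :: nat
  \<comment> \<open>Summing over the whole block stands in for the maximum over \<open>j\<close>. It
    costs a factor \<open>2^m\<close>; the weight in \<open>F\<close> leaves \<open>(1/2)^m\<close>.
    Both signs of \<open>lam m\<close> enter \<open>F\<close> to control absolute values.\<close>
  define E where "E m c \<xi> = (\<Sum>j\<in>{2^m<..2^Suc m}. ennreal (exp (c * (S \<xi> j - S \<xi> (2^m)))))" for m :: nat and c \<xi>
  define F where "F m \<xi> = ennreal ((1/4)^m) * (E m (lam m) \<xi> + E m (- lam m) \<xi>)" for m \<xi>
  have [measurable_cong]: "sets gauss_noise = sets seq_space" by (rule sets_gauss_noise)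
  have S_meas [measurable]: "(\<lambda>\<xi>. S \<xi> j) \<in> borel_measurable gauss_noise" for j
    unfolding S_def by measurable
  have E_meas [measurable]: "E m c \<in> borel_measurable gauss_noise" for m c
    unfolding E_def[abs_def] by measurable
  have F_meas [measurable]: "F m \<in> borel_measurable gauss_noise" for m
    unfolding F_def[abs_def] by measurable
  have E_bound: "(\<integral>\<^sup>+\<xi>. E m c \<xi> \<partial>gauss_noise) \<le> ennreal (2^m * exp (C\<^sup>2 / 2))" if c: "c\<^sup>2 = (lam m)\<^sup>2" for m c
  proof -
    have "(\<integral>\<^sup>+\<xi>. E m c \<xi> \<partial>gauss_noise)
        = (\<Sum>j\<in>{2^m<..2^Suc m}. \<integral>\<^sup>+\<xi>. ennreal (exp (c * (S \<xi> j - S \<xi> (2^m)))) \<partial>gauss_noise)"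
      unfolding E_def by (rule nn_integral_sum) measurable
    also have "\<dots> \<le> (\<Sum>j\<in>{2^m<..2^Suc m::nat}. ennreal (exp (C\<^sup>2 / 2)))"
    proof (rule sum_mono)
      fix j :: nat assume j: "j \<in> {2^m<..2^Suc m}"
      have "{1..j} = {1..2^m} \<union> {2^m<..j}" using j by (auto simp: not_le)
      hence "S \<xi> j - S \<xi> (2^m) = (\<Sum>k\<in>{2^m<..j}. a k * \<xi> k)" for \<xi>
        unfolding S_def by (simp add: sum.union_disjoint ivl_disj_int)
      hence "(\<integral>\<^sup>+\<xi>. ennreal (exp (c * (S \<xi> j - S \<xi> (2^m)))) \<partial>gauss_noise)
          = (\<integral>\<^sup>+\<xi>. ennreal (exp (\<Sum>k\<in>{2^m<..j}. (c * a k) * \<xi> k)) \<partial>gauss_noise)"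
        by (simp add: sum_distrib_left mult.assoc)
      also have "\<dots> = ennreal (exp ((\<Sum>k\<in>{2^m<..j}. (c * a k)\<^sup>2) / 2))"
        by (rule nn_integral_exp_gauss_sum) auto
      also have "(\<Sum>k\<in>{2^m<..j}. (c * a k)\<^sup>2) \<le> (\<Sum>k\<in>{2^m<..j}. C\<^sup>2 / 2^m)"
      proof (rule sum_mono)
        fix k assume k: "k \<in> {2^m<..j}"
        have k0: "real k \<ge> 2^m" using k by (auto simp flip: of_nat_le_iff)
        have C0: "C \<ge> 0" using C[of 1] by simp
        have "\<bar>a k\<bar> \<le> C * real k powr (-b-1/2)" using k by (intro C) auto
        also have "\<dots> \<le> C * (2^m) powr (-b-1/2)"
          using k0 b C0 by (intro mult_left_mono powr_mono2') auto
        finally have "(c * a k)\<^sup>2 \<le> (lam m)\<^sup>2 * (C * (2^m) powr (-b-1/2))\<^sup>2"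
          unfolding power_mult_distrib c by (intro mult_left_mono) (auto simp: abs_le_square_iff[symmetric] simp flip: power_mult_distrib)
        also have "\<dots> = C\<^sup>2 * (lam m * (2^m) powr (-b-1/2))\<^sup>2" by (simp add: power_mult_distrib)
        also have "lam m * (2^m) powr (-b-1/2) = (2^m) powr (-1/2)"
          unfolding lam_def by (simp add: powr_add[symmetric])
        also have "((2^m::real) powr (-1/2))\<^sup>2 = 1 / 2^m"
          by (simp add: powr_minus powr_half_sqrt field_simps)
        finally show "(c * a k)\<^sup>2 \<le> C\<^sup>2 / 2^m" by simp
      qed
      also have "\<dots> = real (j - 2^m) * (C\<^sup>2 / 2^m)" by simp
      also have "real (j - 2^m) \<le> real (2^m)" using j by (subst of_nat_le_iff) auto
      hence "real (j - 2^m) * (C\<^sup>2 / 2^m) \<le> 2^m * (C\<^sup>2 / 2^m)" by (intro mult_right_mono) auto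
      finally show "(\<integral>\<^sup>+\<xi>. ennreal (exp (c * (S \<xi> j - S \<xi> (2^m)))) \<partial>gauss_noise) \<le> ennreal (exp (C\<^sup>2 / 2))"
        by (simp add: ennreal_leI)
    qed
    also have "\<dots> = ennreal (2^m * exp (C\<^sup>2 / 2))"
      by (simp add: ennreal_of_nat_eq_real_of_nat ennreal_mult' del: sum_ennreal)
    finally show ?thesis .
  qed
  have "(\<integral>\<^sup>+\<xi>. (\<Sum>m. F m \<xi>) \<partial>gauss_noise) = (\<Sum>m. \<integral>\<^sup>+\<xi>. F m \<xi> \<partial>gauss_noise)"
    by (rule nn_integral_suminf) measurable
  also have "\<dots> \<le> (\<Sum>m. ennreal ((1/2)^m * (2 * exp (C\<^sup>2 / 2))))"
  proof (rule suminf_le)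
    fix m
    have "(\<integral>\<^sup>+\<xi>. F m \<xi> \<partial>gauss_noise)
        = ennreal ((1/4)^m) * ((\<integral>\<^sup>+\<xi>. E m (lam m) \<xi> \<partial>gauss_noise) + (\<integral>\<^sup>+\<xi>. E m (-lam m) \<xi> \<partial>gauss_noise))"
      unfolding F_def by (subst nn_integral_cmult, measurable) (simp only: nn_integral_add[OF E_meas E_meas])
    also have "\<dots> \<le> ennreal ((1/4)^m) * (ennreal (2^m * exp (C\<^sup>2 / 2)) + ennreal (2^m * exp (C\<^sup>2 / 2)))"
      by (intro mult_left_mono add_mono E_bound) auto
    also have "\<dots> = ennreal ((1/4)^m * (2^m * exp (C\<^sup>2 / 2) + 2^m * exp (C\<^sup>2 / 2)))"
      by (subst ennreal_plus[symmetric], simp, simp, subst ennreal_mult'[symmetric], simp, rule refl)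
    also have "(1/4)^m * (2^m * exp (C\<^sup>2 / 2) + 2^m * exp (C\<^sup>2 / 2)) = (1/4 * 2)^m * (2 * exp (C\<^sup>2 / 2))"
      unfolding power_mult_distrib by simp
    finally show "(\<integral>\<^sup>+\<xi>. F m \<xi> \<partial>gauss_noise) \<le> ennreal ((1/2)^m * (2 * exp (C\<^sup>2 / 2)))" by simp
  qed auto
  also have "\<dots> = ennreal (\<Sum>m. (1/2)^m * (2 * exp (C\<^sup>2 / 2)))"
    by (intro suminf_ennreal2 summable_mult2 summable_geometric) auto
  finally have "(\<integral>\<^sup>+\<xi>. (\<Sum>m. F m \<xi>) \<partial>gauss_noise) \<noteq> \<infinity>"
    by (auto simp: top_unique)
  hence "AE \<xi> in gauss_noise. (\<Sum>m. F m \<xi>) \<noteq> \<infinity>"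
    by (intro nn_integral_PInf_AE) measurable
  thus ?thesis
  proof eventually_elim
    case (elim \<xi>)
    have "\<forall>\<^sub>F m in sequentially. F m \<xi> \<le> 1"
    proof -
      have fin: "F m \<xi> < \<infinity>" for m
        using elim le_less_trans[OF sum_le_suminf[of "\<lambda>m. F m \<xi>" "{m}"], of \<infinity>] by (auto simp: less_top)
      define g where "g m = enn2real (F m \<xi>)" for m
      have g: "F m \<xi> = ennreal (g m)" for m using fin[of m] by (simp add: g_def less_top)
      have "summable g" using elim unfolding g by (intro summable_suminf_not_top) (auto simp: g_def)
      hence "g \<longlonglongrightarrow> 0" by (rule summable_LIMSEQ_zero)
      hence "\<forall>\<^sub>F m in sequentially. g m < 1" by (rule order_tendstoD) simp
      thus ?thesis by eventually_elim (auto simp: g intro: ennreal_leI[of _ 1, simplified])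
    qed
    \<comment> \<open>A finite sum has terms tending to 0, so eventually
      \<open>F m \<xi> \<le> 1\<close>. Then each single exponential in it is at most
      \<open>4^m\<close>, and taking logarithms gives oscillations of order
      \<open>m / lam m\<close>.\<close>
    hence osc: "\<forall>\<^sub>F m in sequentially. \<forall>j\<in>{2^m<..2^Suc m}. \<bar>S \<xi> j - S \<xi> (2^m)\<bar> \<le> ln 4 * (real (Suc m) * (2 powr (-b))^m)"
    proof eventually_elim
      case (elim m)
      show ?case
      proof
        fix j :: nat assume j: "j \<in> {2^m<..2^Suc m}"
        let ?x = "S \<xi> j - S \<xi> (2^m)"
        have lam: "lam m > 0" by (simp add: lam_def)
        have *: "c * ?x \<le> real m * ln 4" if c: "c = lam m \<or> c = - lam m" for c
        proof -
          have "ennreal ((1/4)^m) * ennreal (exp (c * ?x)) \<le> ennreal ((1/4)^m) * E m c \<xi>"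
            unfolding E_def using j by (intro mult_left_mono sum_nonneg_leq_bound[OF _ _ refl] member_le_sum) auto
          also have "\<dots> \<le> F m \<xi>" unfolding F_def using c by (intro mult_left_mono) auto
          also have "\<dots> \<le> 1" by fact
          finally have "(1/4)^m * exp (c * ?x) \<le> 1"
            by (simp flip: ennreal_mult' ennreal_1)
          hence "exp (c * ?x) \<le> 4 ^ m" by (simp add: field_simps power_divide)
          hence "ln (exp (c * ?x)) \<le> ln (4^m)" by (subst ln_le_cancel_iff) auto
          thus ?thesis by (simp add: ln_realpow)
        qed
        have "lam m * \<bar>?x\<bar> \<le> real m * ln 4" using *[of "lam m"] *[of "- lam m"] by (auto simp: abs_if algebra_simps)
        hence "\<bar>?x\<bar> \<le> real m * ln 4 / lam m" using lam by (simp add: field_simps)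
        also have "\<dots> = ln 4 * (real m * (2 powr (-b))^m)"
          unfolding lam_def by (simp add: powr_minus powr_powr powr_realpow[symmetric] field_simps)
        \<comment> \<open>\<open>Suc m\<close> fits the differentiated geometric series
          \<open>geometric_deriv_sums\<close>.\<close>
        also have "\<dots> \<le> ln 4 * (real (Suc m) * (2 powr (-b))^m)"
          by (intro mult_left_mono mult_right_mono) auto
        finally show "\<bar>?x\<bar> \<le> ln 4 * (real (Suc m) * (2 powr (-b))^m)" .
      qed
    qed
    have "2 powr (-b) < 2 powr (0::real)" using b by (intro powr_less_mono) auto
    hence "summable (\<lambda>m. real (Suc m) * (2 powr (-b))^m)"
      by (intro sums_summable[OF geometric_deriv_sums]) auto
    from convergent_if_dyadic_oscillation_summable[OF summable_mult[OF this] osc]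
    show ?case
      by (simp add: summable_iff_convergent S_def sum_Suc_shift[of "\<lambda>k. a k * \<xi> k"])
  qed
qed

text \<open>Fatou along the partial sums. Every later use is an upper bound, so no uniform
  integrability has to be shown.\<close>

lemma nn_integral_exp_gauss_series_le:
  assumes b: "b > 0" and a: "poly_decay b a"
  shows "(\<integral>\<^sup>+\<xi>. ennreal (exp (\<Sum>k. a (Suc k) * \<xi> (Suc k))) \<partial>gauss_noise)
       \<le> ennreal (exp ((\<Sum>k. (a (Suc k))\<^sup>2) / 2))"
proof -
  have [measurable_cong]: "sets gauss_noise = sets seq_space" by (rule sets_gauss_noise)
  let ?S = "\<lambda>\<xi> m. \<Sum>k<m. a (Suc k) * \<xi> (Suc k)"
  have sq: "(\<lambda>m. \<Sum>k<m. (a (Suc k))\<^sup>2) \<longlonglongrightarrow> (\<Sum>k. (a (Suc k))\<^sup>2)"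
    using poly_decay_summable_mult[OF b a a] by (intro summable_LIMSEQ) (simp add: power2_eq_square)
  have "(\<integral>\<^sup>+\<xi>. ennreal (exp (\<Sum>k. a (Suc k) * \<xi> (Suc k))) \<partial>gauss_noise)
      = (\<integral>\<^sup>+\<xi>. liminf (\<lambda>m. ennreal (exp (?S \<xi> m))) \<partial>gauss_noise)"
  proof (rule nn_integral_cong_AE)
    from AE_summable_gauss_series[OF b a]
    show "AE \<xi> in gauss_noise. ennreal (exp (\<Sum>k. a (Suc k) * \<xi> (Suc k))) = liminf (\<lambda>m. ennreal (exp (?S \<xi> m)))"
    proof eventually_elim
      case (elim \<xi>)
      have "(\<lambda>m. ennreal (exp (?S \<xi> m))) \<longlonglongrightarrow> ennreal (exp (\<Sum>k. a (Suc k) * \<xi> (Suc k)))"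
        by (intro tendsto_ennrealI tendsto_exp summable_LIMSEQ elim)
      thus ?case by (intro lim_imp_Liminf[symmetric]) auto
    qed
  qed
  also have "\<dots> \<le> liminf (\<lambda>m. \<integral>\<^sup>+\<xi>. ennreal (exp (?S \<xi> m)) \<partial>gauss_noise)"
    by (rule nn_integral_liminf) measurable
  also have "(\<lambda>m. \<integral>\<^sup>+\<xi>. ennreal (exp (?S \<xi> m)) \<partial>gauss_noise)
      = (\<lambda>m. ennreal (exp ((\<Sum>k<m. (a (Suc k))\<^sup>2) / 2)))"
    unfolding sum_Suc_shift[of "\<lambda>k. a k * \<xi> k" for \<xi>] sum_Suc_shift[of "\<lambda>k. (a k)\<^sup>2"]
    by (intro ext nn_integral_exp_gauss_sum) auto
  also have "liminf \<dots> = ennreal (exp ((\<Sum>k. (a (Suc k))\<^sup>2) / 2))"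
    by (intro lim_imp_Liminf tendsto_ennrealI tendsto_exp tendsto_divide sq) auto
  finally show ?thesis .
qed

section \<open>Moments of the likelihood ratio\<close>

lemma measurable_shift_scale [measurable]:
  "(\<lambda>\<xi>. \<lambda>k\<in>{1..}. f k + \<xi> k / sqrt (real n)) \<in> gauss_noise \<rightarrow>\<^sub>M seq_space"
proof -
  have [measurable_cong]: "sets gauss_noise = sets seq_space" by (rule sets_gauss_noise)
  show ?thesis by measurable
qed

lemma measurable_log_lik [measurable]:
  "(\<lambda>z. log_lik n (fst z) (snd z)) \<in> borel_measurable (seq_space \<Otimes>\<^sub>M seq_space)"
  unfolding log_lik_def by measurable

text \<open>Under the law at \<open>f0\<close>, the log-likelihood ratio is Gaussian with mean
  \<open>- n * D / 2\<close> and variance \<open>n * D\<close>, where \<open>D\<close> is the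
  squared distance. The exponent is then \<open>- s / 2 + s\<^sup>2 / 2 = - s * (1 - s) / 2\<close>
  times \<open>n * D\<close>. Since \<open>s\<close> is any real number, negative powers are
  covered.\<close>

lemma nn_integral_exp_log_lik_diff_le:
  assumes b: "b > 0" and f: "poly_decay b f" and f0: "poly_decay b f0" and n: "n \<ge> 1"
  shows "(\<integral>\<^sup>+X. ennreal (exp (s * (log_lik n f X - log_lik n f0 X))) \<partial>gauss_seq_model n f0)
       \<le> ennreal (exp (- (s * (1 - s)) / 2 * (real n * (\<Sum>k. (f (Suc k) - f0 (Suc k))\<^sup>2))))"
proof -
  let ?T = "\<lambda>\<xi>. \<lambda>k\<in>{1..}. f0 k + \<xi> k / sqrt (real n)"
  define d where "d k = f k - f0 k" for k
  define D where "D = (\<Sum>k. (d (Suc k))\<^sup>2)"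
  have d: "poly_decay b d" unfolding d_def by (rule poly_decay_diff[OF f f0])
  have sm: "summable (\<lambda>k. f (Suc k) * f (Suc k))" "summable (\<lambda>k. f0 (Suc k) * f (Suc k))"
     "summable (\<lambda>k. f0 (Suc k) * f0 (Suc k))"
    by (intro poly_decay_summable_mult[OF b] f f0)+
  have [measurable]: "(\<lambda>X. log_lik n g X) \<in> borel_measurable seq_space" for g
    unfolding log_lik_def by measurable
  have "(\<integral>\<^sup>+X. ennreal (exp (s * (log_lik n f X - log_lik n f0 X))) \<partial>gauss_seq_model n f0)
     = (\<integral>\<^sup>+\<xi>. ennreal (exp (s * (log_lik n f (?T \<xi>) - log_lik n f0 (?T \<xi>)))) \<partial>gauss_noise)"
    unfolding gauss_seq_model_def by (rule nn_integral_distr) measurable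
  also have "\<dots> = (\<integral>\<^sup>+\<xi>. ennreal (exp (- s / 2 * (real n * D))) *
       ennreal (exp (\<Sum>k. (s * sqrt (real n) * d (Suc k)) * \<xi> (Suc k))) \<partial>gauss_noise)"
  proof (rule nn_integral_cong_AE)
    \<comment> \<open>Two convergence statements are needed: \<open>log_lik\<close> at
      \<open>f\<close> and at \<open>f0\<close> are separate series, and they may be subtracted only
      where both converge.\<close>
    from AE_summable_gauss_series[OF b f] AE_summable_gauss_series[OF b f0]
    show "AE \<xi> in gauss_noise. ennreal (exp (s * (log_lik n f (?T \<xi>) - log_lik n f0 (?T \<xi>))))
       = ennreal (exp (- s / 2 * (real n * D))) *
       ennreal (exp (\<Sum>k. (s * sqrt (real n) * d (Suc k)) * \<xi> (Suc k)))"
    proof eventually_elim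
      case (elim \<xi>)
      let ?F = "\<Sum>k. f (Suc k) * f (Suc k)" and ?G = "\<Sum>k. f0 (Suc k) * f (Suc k)"
        and ?H = "\<Sum>k. f0 (Suc k) * f0 (Suc k)"
      let ?A = "\<Sum>k. f (Suc k) * \<xi> (Suc k)" and ?B = "\<Sum>k. f0 (Suc k) * \<xi> (Suc k)"
      have "(\<lambda>k. f0 (Suc k) * f (Suc k) + 1 / sqrt n * (f (Suc k) * \<xi> (Suc k))) sums (?G + 1 / sqrt n * ?A)"
        by (intro sums_add sums_mult summable_sums sm elim)
      hence 1: "(\<Sum>k. ?T \<xi> (Suc k) * f (Suc k)) = ?G + 1 / sqrt n * ?A"
        by (intro sums_unique[symmetric]) (simp add: algebra_simps)
      have "(\<lambda>k. f0 (Suc k) * f0 (Suc k) + 1 / sqrt n * (f0 (Suc k) * \<xi> (Suc k))) sums (?H + 1 / sqrt n * ?B)"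
        by (intro sums_add sums_mult summable_sums sm elim)
      hence 2: "(\<Sum>k. ?T \<xi> (Suc k) * f0 (Suc k)) = ?H + 1 / sqrt n * ?B"
        by (intro sums_unique[symmetric]) (simp add: algebra_simps)
      have "(\<lambda>k. f (Suc k) * f (Suc k) - 2 * (f0 (Suc k) * f (Suc k)) + f0 (Suc k) * f0 (Suc k)) sums (?F - 2 * ?G + ?H)"
        by (intro sums_add sums_diff sums_mult summable_sums sm)
      hence 3: "D = ?F - 2 * ?G + ?H"
        unfolding D_def d_def
        by (intro sums_unique[symmetric]) (simp add: power2_eq_square algebra_simps)
      have "(\<lambda>k. s * sqrt n * (f (Suc k) * \<xi> (Suc k) - f0 (Suc k) * \<xi> (Suc k))) sums (s * sqrt n * (?A - ?B))"
        by (intro sums_mult sums_diff summable_sums elim)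
      hence 4: "(\<Sum>k. (s * sqrt n * d (Suc k)) * \<xi> (Suc k)) = s * sqrt n * (?A - ?B)"
        unfolding d_def by (intro sums_unique[symmetric]) (simp add: algebra_simps)
      have sn: "real n / sqrt n = sqrt n" using n by (simp add: real_div_sqrt)
      have "s * (log_lik n f (?T \<xi>) - log_lik n f0 (?T \<xi>))
          = - s / 2 * (real n * (?F - 2 * ?G + ?H)) + s * (real n / sqrt n) * (?A - ?B)"
        unfolding log_lik_def 1 2 power2_eq_square using n by (simp add: field_simps)
      also have "\<dots> = - s / 2 * (real n * D) + (\<Sum>k. (s * sqrt n * d (Suc k)) * \<xi> (Suc k))"
        unfolding 3 4 sn by simp
      finally show ?case by (simp only: exp_add) (simp add: ennreal_mult')
    qed
  qed
  also have "\<dots> = ennreal (exp (- s / 2 * (real n * D))) *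
       (\<integral>\<^sup>+\<xi>. ennreal (exp (\<Sum>k. (s * sqrt (real n) * d (Suc k)) * \<xi> (Suc k))) \<partial>gauss_noise)"
  proof (rule nn_integral_cmult)
    have [measurable_cong]: "sets gauss_noise = sets seq_space" by (rule sets_gauss_noise)
    show "(\<lambda>\<xi>. ennreal (exp (\<Sum>k. s * sqrt (real n) * d (Suc k) * \<xi> (Suc k)))) \<in> borel_measurable gauss_noise"
      by measurable
  qed
  also have "\<dots> \<le> ennreal (exp (- s / 2 * (real n * D))) *
      ennreal (exp ((\<Sum>k. (s * sqrt (real n) * d (Suc k))\<^sup>2) / 2))"
    by (intro mult_left_mono nn_integral_exp_gauss_series_le[OF b] poly_decay_cmult d) auto
  also have "(\<Sum>k. (s * sqrt (real n) * d (Suc k))\<^sup>2) = s\<^sup>2 * real n * D"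
    unfolding D_def power_mult_distrib
    using poly_decay_summable_mult[OF b d d] by (subst suminf_mult) (auto simp: power2_eq_square)
  also have "ennreal (exp (- s / 2 * (real n * D))) * ennreal (exp (s\<^sup>2 * real n * D / 2))
      = ennreal (exp (- (s * (1 - s)) / 2 * (real n * D)))"
    by (simp add: ennreal_mult'[symmetric] exp_add[symmetric] power2_eq_square field_simps)
  finally show ?thesis by (simp add: D_def d_def)
qed

section \<open>Exponential power priors\<close>

text \<open>An integrable envelope for all unnormalised exponential power densities that does not
  depend on \<open>p\<close>.\<close>

lemma has_bochner_integral_cauchy: "has_bochner_integral lborel (\<lambda>x::real. 2 / (1 + x\<^sup>2)) (2 * pi)"
proof -
  have "(\<integral>\<^sup>+x. ennreal (indicator {0..} x *\<^sub>R (2 / (1 + x\<^sup>2))) \<partial>lborel)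
      = (\<integral>\<^sup>+x. ennreal (2 / (1 + x\<^sup>2)) * indicator {0..} x \<partial>lborel)"
    by (intro nn_integral_cong) (simp split: split_indicator)
  also have "\<dots> = ennreal (pi - 2 * arctan 0)"
  proof (rule nn_integral_FTC_atLeast)
    have "((\<lambda>x. 2 * arctan x) \<longlongrightarrow> 2 * (pi / 2)) at_top"
      by (intro tendsto_intros tendsto_arctan_at_top)
    thus "((\<lambda>x. 2 * arctan x) \<longlongrightarrow> pi) at_top" by simp
  qed (auto intro!: derivative_eq_intros simp: add_nonneg_eq_0_iff field_simps power2_eq_square)
  finally have "has_bochner_integral lborel (\<lambda>x::real. indicator {0..} x *\<^sub>R (2 / (1 + x\<^sup>2))) pi"
    by (intro has_bochner_integral_nn_integral) auto
  from has_bochner_integral_even_function[OF this] show ?thesis by simp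
qed

definition exp_power_mass :: "real \<Rightarrow> real" where
  "exp_power_mass p = (\<integral>s. exp (- (\<bar>s\<bar> powr p) / p) \<partial>lborel)"

abbreviation exp_power_law :: "real \<Rightarrow> real measure" where
  "exp_power_law p \<equiv> density lborel (\<lambda>t. ennreal (exp_power_density p t))"

lemma exp_power_density_eq: "exp_power_density p t = exp (- (\<bar>t\<bar> powr p) / p) / exp_power_mass p"
  by (simp add: exp_power_density_def exp_power_mass_def)

text \<open>The hypothesis divided by \<open>p\<close> says
  \<open>ln (t\<^sup>2) \<le> c / p\<close>. The variable \<open>c\<close> allows two uses: the full
  exponent for the envelope, and the reduced exponent \<open>3 * x / 4 - 3 / 2\<close> in the tail
  bound.\<close>

lemma exp_power_le_cauchy_aux:
  fixes p t c :: real
  assumes p: "p > 0" and t: "\<bar>t\<bar> > 1" and c: "2 * ln (\<bar>t\<bar> powr p) \<le> c"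
  shows "exp (- c / p) \<le> 2 / (1 + t\<^sup>2)"
proof -
  have "ln (t\<^sup>2) = 2 * ln \<bar>t\<bar>" using t ln_realpow[of "\<bar>t\<bar>" 2] by simp
  also have "\<dots> = 2 * ln (\<bar>t\<bar> powr p) / p" using p t by (simp add: ln_powr)
  also have "\<dots> \<le> c / p" using c p by (intro divide_right_mono) auto
  finally have "exp (- c / p) \<le> exp (- ln (t\<^sup>2))" by simp
  also have "\<dots> = 1 / t\<^sup>2" using t by (subst exp_minus, subst exp_ln) (auto simp: divide_inverse)
  also have "\<dots> \<le> 2 / (1 + t\<^sup>2)"
  proof -
    have "1 < t\<^sup>2" using t by (metis one_less_power power2_abs zero_less_numeral)
    moreover have "1 / y \<le> 2 / (1 + y)" if "1 < y" for y :: real using that by (simp add: field_simps)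
    ultimately show ?thesis by blast
  qed
  finally show ?thesis .
qed

lemma exp_power_le_cauchy:
  fixes p t :: real
  assumes p: "p > 0"
  shows "exp (- (\<bar>t\<bar> powr p) / p) \<le> 2 / (1 + t\<^sup>2)"
proof (cases "\<bar>t\<bar> \<le> 1")
  case True
  hence "t\<^sup>2 \<le> 1" using power_le_one[of "\<bar>t\<bar>" 2] by simp
  have "exp (- (\<bar>t\<bar> powr p) / p) \<le> 1" using p by simp
  also have "1 \<le> 2 / (1 + t\<^sup>2)" using \<open>t\<^sup>2 \<le> 1\<close> by (simp add: field_simps add_pos_nonneg)
  finally show ?thesis .
next
  case False
  define x where "x = \<bar>t\<bar> powr p"
  have x: "x > 0" using False by (simp add: x_def)
  \<comment> \<open>Tangent of \<open>ln\<close> at 2; the leftover constant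
    \<open>2 * ln 2 - 2\<close> is negative.\<close>
  have "ln (x / 2) \<le> x / 2 - 1" using x by (intro ln_le_minus_one) auto
  hence "2 * ln x \<le> x" using x ln2_le_25_over_36 by (simp add: ln_div)
  thus ?thesis using False p unfolding x_def by (intro exp_power_le_cauchy_aux) auto
qed

lemma integrable_exp_power:
  assumes "p > 0" shows "integrable lborel (\<lambda>t::real. exp (- (\<bar>t\<bar> powr p) / p))"
  by (rule Bochner_Integration.integrable_bound[OF integrable.intros[OF has_bochner_integral_cauchy]])
    (use exp_power_le_cauchy[OF assms] in auto)

lemma exp_power_mass_le:
  assumes "p > 0" shows "exp_power_mass p \<le> 2 * pi"
proof -
  have "exp_power_mass p \<le> (\<integral>x. 2 / (1 + x\<^sup>2) \<partial>lborel)"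
    unfolding exp_power_mass_def
    by (intro integral_mono integrable_exp_power assms exp_power_le_cauchy
        integrable.intros[OF has_bochner_integral_cauchy])
  thus ?thesis using has_bochner_integral_integral_eq[OF has_bochner_integral_cauchy] by simp
qed

text \<open>On \<open>{-1..1}\<close> the exponent is at most \<open>1 / p\<close>. The factor
  \<open>exp (- 1 / p)\<close> degenerates as \<open>p\<close> tends to 0 and is kept explicit,
  because it cancels against the same factor in the numerator of the tail bound.\<close>

lemma exp_power_mass_ge:
  assumes p: "p > 0" shows "2 * exp (- 1 / p) \<le> exp_power_mass p"
proof -
  have "2 * exp (- 1 / p) = (\<integral>x. indicator {-1..1::real} x *\<^sub>R exp (- 1 / p) \<partial>lborel)" by (simp add: content_real)
  also have "\<dots> \<le> exp_power_mass p"
    unfolding exp_power_mass_def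
  proof (intro integral_mono integrable_exp_power p)
    fix x :: real
    have "\<bar>x\<bar> powr p \<le> 1" if "\<bar>x\<bar> \<le> 1" using powr_mono2[of p "\<bar>x\<bar>" 1] p that by simp
    hence "exp (- 1 / p) \<le> exp (- (\<bar>x\<bar> powr p) / p)" if "\<bar>x\<bar> \<le> 1"
      using p that by (simp add: field_simps)
    thus "indicator {-1..1} x *\<^sub>R exp (- 1 / p) \<le> exp (- (\<bar>x\<bar> powr p) / p)"
      by (auto simp: indicator_def)
  qed auto
  finally show ?thesis .
qed

lemma exp_power_mass_pos: "p > 0 \<Longrightarrow> exp_power_mass p > 0"
  using exp_power_mass_ge[of p] exp_gt_zero[of "- 1 / p"] by linarith

lemma borel_measurable_exp_power_density [measurable]: "exp_power_density p \<in> borel_measurable borel"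
  unfolding exp_power_density_eq[abs_def] by measurable

lemma emeasure_exp_power_law:
  assumes p: "p > 0" and A: "A \<in> sets borel"
  shows "emeasure (exp_power_law p) A = ennreal ((\<integral>t. indicator A t *\<^sub>R exp (- (\<bar>t\<bar> powr p) / p) \<partial>lborel) / exp_power_mass p)"
proof -
  have [measurable]: "A \<in> sets borel" by fact
  have "emeasure (exp_power_law p) A = (\<integral>\<^sup>+t. ennreal (indicator A t *\<^sub>R exp_power_density p t) \<partial>lborel)"
    by (subst emeasure_density) (auto intro!: nn_integral_cong split: split_indicator)
  also have "\<dots> = ennreal (\<integral>t. indicator A t *\<^sub>R exp_power_density p t \<partial>lborel)"
  proof (rule nn_integral_eq_integral)
    have "integrable lborel (\<lambda>t. exp_power_density p t)"
      unfolding exp_power_density_eq using integrable_exp_power[OF p] by simp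
    thus "integrable lborel (\<lambda>t. indicator A t *\<^sub>R exp_power_density p t)"
      by (intro integrable_mult_indicator) auto
  qed (auto simp: exp_power_density_eq exp_power_mass_pos[OF p, THEN less_imp_le])
  also have "(\<integral>t. indicator A t *\<^sub>R exp_power_density p t \<partial>lborel)
      = (\<integral>t. indicator A t *\<^sub>R exp (- (\<bar>t\<bar> powr p) / p) \<partial>lborel) / exp_power_mass p"
    unfolding exp_power_density_eq by simp
  finally show ?thesis .
qed

lemma prob_space_exp_power_law:
  assumes p: "p > 0" shows "prob_space (exp_power_law p)"
proof
  show "emeasure (exp_power_law p) (space (exp_power_law p)) = 1"
    using emeasure_exp_power_law[OF p, of UNIV] exp_power_mass_pos[OF p]
    by (simp add: exp_power_mass_def)
qed

section \<open>Tail and small ball probabilities of one coordinate\<close>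

text \<open>The point is a constant that does not depend on \<open>p\<close>. Beyond
  \<open>r\<close> the unnormalised density is compared with the Cauchy envelope times
  \<open>exp (- 1 / p)\<close> times the desired exponential; the threshold 8 leaves enough exponent
  for all three.\<close>

lemma exp_power_law_tail:
  assumes p: "0 < p" "p \<le> 1" and r: "r \<ge> 0" "r powr p \<ge> 8"
  shows "measure (exp_power_law p) {t. \<bar>t\<bar> > r} \<le> 8/3 * exp (- (r powr p / p) / 4)"
proof -
  let ?z = "r powr p / p"
  have pw: "indicator {t. \<bar>t\<bar> > r} t *\<^sub>R exp (- (\<bar>t\<bar> powr p) / p)
      \<le> (2 / 3 * exp (- 1 / p) * exp (- ?z / 4)) * (2 / (1 + t\<^sup>2))" for t
  proof (cases "\<bar>t\<bar> > r")
    case True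
    define x where "x = \<bar>t\<bar> powr p"
    have xr: "x \<ge> r powr p" unfolding x_def using True r p by (intro powr_mono2) auto
    hence x8: "x \<ge> 8" using r by simp
    have "\<bar>t\<bar> > 1"
    proof (rule ccontr)
      assume "\<not> \<bar>t\<bar> > 1"
      hence "x \<le> 1" unfolding x_def using powr_mono2[of p "\<bar>t\<bar>" 1] p by simp
      with x8 show False by simp
    qed
    \<comment> \<open>Tangent of \<open>ln\<close> at 8: the resulting bound on
      \<open>2 * ln x\<close> grows like \<open>x / 4\<close>, which
      \<open>3 * x / 4 - 3 / 2\<close> dominates from \<open>x = 8\<close> on.\<close>
    have "ln (x / 8) \<le> x / 8 - 1" using x8 by (intro ln_le_minus_one) auto
    moreover have "ln (8::real) = 3 * ln 2" using ln_realpow[of 2 3] by simp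
    ultimately have lnx: "2 * ln x \<le> 3 * x / 4 - 3 / 2" using x8 ln2_le_25_over_36 by (simp add: ln_div)
    \<comment> \<open>The exponent \<open>x\<close> is split as
      \<open>1/2 + 1 + x / 4 + (3 * x / 4 - 3 / 2)\<close>: a numerical factor, the part that
      cancels the lower bound of the mass, the tail rate, and the part that dominates the Cauchy
      envelope.\<close>
    have "exp (- x / p) = exp (- (1/2) / p) * exp (- 1 / p) * exp (- (x / p) / 4) * exp (- (3 * x / 4 - 3 / 2) / p)"
      using p by (simp add: exp_add[symmetric] field_simps)
    also have "\<dots> \<le> 2/3 * exp (- 1 / p) * exp (- ?z / 4) * (2 / (1 + t\<^sup>2))"
    proof (intro mult_mono)
      have "exp (- (1/2) / p) \<le> exp (- (1/2))" using p by (simp add: field_simps)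
      also have "\<dots> \<le> 2 / 3" using exp_ge_add_one_self[of "1/2"] by (simp add: exp_minus field_simps)
      finally show "exp (- (1/2) / p) \<le> 2 / 3" .
      show "exp (- (x / p) / 4) \<le> exp (- ?z / 4)" using xr p by (simp add: field_simps)
      show "exp (- (3 * x / 4 - 3 / 2) / p) \<le> 2 / (1 + t\<^sup>2)"
        using lnx \<open>\<bar>t\<bar> > 1\<close> p unfolding x_def by (intro exp_power_le_cauchy_aux) auto
    qed auto
    finally show ?thesis using True by (simp add: x_def)
  qed (auto intro!: mult_nonneg_nonneg divide_nonneg_nonneg)
  have "(\<integral>t. indicator {t. \<bar>t\<bar> > r} t *\<^sub>R exp (- (\<bar>t\<bar> powr p) / p) \<partial>lborel)
      \<le> (\<integral>t. (2 / 3 * exp (- 1 / p) * exp (- ?z / 4)) * (2 / (1 + t\<^sup>2)) \<partial>lborel)"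
    using p by (intro integral_mono pw integrable_mult_indicator integrable_exp_power
        integrable_mult_right integrable.intros[OF has_bochner_integral_cauchy]) auto
  also have "\<dots> = (2 / 3 * exp (- 1 / p) * exp (- ?z / 4)) * (2 * pi)"
    using has_bochner_integral_integral_eq[OF has_bochner_integral_cauchy] 
    by (subst integral_mult_right_zero) simp
  also have "\<dots> \<le> (2 / 3 * exp (- 1 / p) * exp (- ?z / 4)) * (2 * 4)"
    using pi_less_4 by (intro mult_left_mono) auto
  finally have "(\<integral>t. indicator {t. \<bar>t\<bar> > r} t *\<^sub>R exp (- (\<bar>t\<bar> powr p) / p) \<partial>lborel) / exp_power_mass p
     \<le> (2 / 3 * exp (- 1 / p) * exp (- ?z / 4)) * (2 * 4) / (2 * exp (- 1 / p))"
    using exp_power_mass_ge[of p] p by (intro frac_le) auto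
  also have "\<dots> = 8/3 * exp (- ?z / 4)" by simp
  finally have le: "(\<integral>t. indicator {t. \<bar>t\<bar> > r} t *\<^sub>R exp (- (\<bar>t\<bar> powr p) / p) \<partial>lborel) / exp_power_mass p \<le> 8/3 * exp (- ?z / 4)" .
  have "emeasure (exp_power_law p) {t. \<bar>t\<bar> > r} \<le> ennreal (8/3 * exp (- ?z / 4))"
    by (subst emeasure_exp_power_law[OF p(1)], simp, rule ennreal_leI[OF le])
  thus ?thesis unfolding measure_def by (intro enn2real_leI) auto
qed

text \<open>The exponential form is chosen for infinite products: over many coordinates the costs
  add up to a convergent series. For a tail probability \<open>q \<le> 1/2\<close> one has
  \<open>ln (1 - q) \<ge> - 2 * q\<close>, and \<open>2 * 8/3 < 6\<close>.\<close>

lemma exp_power_law_central: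
  assumes p: "0 < p" "p \<le> 1" and r: "r \<ge> 0" "r powr p \<ge> 8"
  shows "exp (- 6 * exp (- (r powr p / p) / 4)) \<le> measure (exp_power_law p) {t. \<bar>t\<bar> \<le> r}"
proof -
  interpret prob_space "exp_power_law p" by (rule prob_space_exp_power_law) fact
  let ?q = "measure (exp_power_law p) {t. \<bar>t\<bar> > r}" and ?e = "exp (- (r powr p / p) / 4)"
  have q: "?q \<le> 8/3 * ?e" "?q \<ge> 0" using exp_power_law_tail[OF p r] by auto
  have "8 \<le> r powr p / p" using p r by (simp add: field_simps)
  hence "?e \<le> exp (-2)" by simp
  \<comment> \<open>\<open>(5/4)^8\<close> exceeds \<open>16/3\<close>, so \<open>exp (-2)\<close>
    is at most \<open>3/16\<close>, which is what \<open>8/3 * exp (-2) \<le> 1/2\<close>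
    requires.\<close>
  also have "(5/4::real)^8 \<le> exp (1/4) ^ 8" 
    using exp_ge_add_one_self[of "1/4"] by (intro power_mono) auto
  hence "(5/4::real)^8 \<le> exp 2" by (simp flip: exp_of_nat_mult)
  hence "exp (-2::real) \<le> 3/16" by (simp add: exp_minus field_simps)
  finally have q2: "?q \<le> 1/2" using q by linarith
  have "?q\<^sup>2 \<le> ?q * (1/2)" unfolding power2_eq_square using q2 q by (intro mult_left_mono) auto
  hence "- 2 * ?q \<le> - ?q - 2 * ?q\<^sup>2" by linarith
  also have "\<dots> \<le> ln (1 - ?q)" by (rule ln_one_minus_pos_lower_bound) (use q q2 in auto)
  finally have "- 6 * ?e \<le> ln (1 - ?q)" using q exp_gt_zero[of "- (r powr p / p) / 4"] by linarith
  hence "exp (- 6 * ?e) \<le> exp (ln (1 - ?q))" by simp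
  also have "\<dots> = 1 - ?q" using q2 by simp
  also have "\<dots> = measure (exp_power_law p) (space (exp_power_law p) - {t. \<bar>t\<bar> > r})"
    by (subst prob_compl) auto
  also have "space (exp_power_law p) - {t. \<bar>t\<bar> > r} = {t. \<bar>t\<bar> \<le> r}" by auto
  finally show ?thesis .
qed

text \<open>The density decreases in \<open>\<bar>t\<bar>\<close>, so on the interval it is at least
  its value at modulus \<open>(\<bar>c\<bar> + \<delta>) / \<sigma>\<close>. The interval has length
  \<open>2 * \<delta> / \<sigma>\<close>, and the mass is at most \<open>2 * pi\<close>.\<close>

lemma exp_power_law_small_ball:
  assumes p: "p > 0" and \<sigma>: "\<sigma> > 0" and \<delta>: "\<delta> \<ge> 0"
  shows "\<delta> / (\<sigma> * pi) * exp (- (((\<bar>c\<bar> + \<delta>) / \<sigma>) powr p / p)) \<le> measure (exp_power_law p) {t. \<bar>\<sigma> * t - c\<bar> \<le> \<delta>}"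
proof -
  let ?E = "exp (- (((\<bar>c\<bar> + \<delta>) / \<sigma>) powr p / p))"
  have A: "{t. \<bar>\<sigma> * t - c\<bar> \<le> \<delta>} = {(c - \<delta>) / \<sigma> .. (c + \<delta>) / \<sigma>}"
    using \<sigma> by (auto simp: field_simps abs_le_iff)
  have "2 * \<delta> / \<sigma> * ?E = (\<integral>t. indicator {t. \<bar>\<sigma> * t - c\<bar> \<le> \<delta>} t *\<^sub>R ?E \<partial>lborel)"
    unfolding A using \<sigma> \<delta> by (simp add: measure_lborel_Icc divide_right_mono field_simps)
  also have "\<dots> \<le> (\<integral>t. indicator {t. \<bar>\<sigma> * t - c\<bar> \<le> \<delta>} t *\<^sub>R exp (- (\<bar>t\<bar> powr p) / p) \<partial>lborel)"
  proof (rule integral_mono)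
    show "integrable lborel (\<lambda>t. indicator {t. \<bar>\<sigma> * t - c\<bar> \<le> \<delta>} t *\<^sub>R exp (- (\<bar>t\<bar> powr p) / p))"
      by (intro integrable_mult_indicator integrable_exp_power p) auto
    show "integrable lborel (\<lambda>t. indicator {t. \<bar>\<sigma> * t - c\<bar> \<le> \<delta>} t *\<^sub>R ?E)"
      unfolding A by (intro integrable_scaleR_left integrable_real_indicator) (auto simp: emeasure_lborel_Icc_eq)
    fix t
    have "\<bar>t\<bar> powr p \<le> ((\<bar>c\<bar> + \<delta>) / \<sigma>) powr p" if "\<bar>\<sigma> * t - c\<bar> \<le> \<delta>"
    proof (rule powr_mono2)
      have "\<sigma> * \<bar>t\<bar> = \<bar>\<sigma> * t\<bar>" using \<sigma> by (simp add: abs_mult)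
      also have "\<dots> \<le> \<bar>c\<bar> + \<delta>" using that by linarith
      finally show "\<bar>t\<bar> \<le> (\<bar>c\<bar> + \<delta>) / \<sigma>" using \<sigma> by (simp add: field_simps)
    qed (use p in auto)
    thus "indicator {t. \<bar>\<sigma> * t - c\<bar> \<le> \<delta>} t *\<^sub>R ?E \<le> indicator {t. \<bar>\<sigma> * t - c\<bar> \<le> \<delta>} t *\<^sub>R exp (- (\<bar>t\<bar> powr p) / p)"
      using p by (auto simp: indicator_def divide_right_mono)
  qed
  finally have "2 * \<delta> / \<sigma> * ?E / (2 * pi) \<le> (\<integral>t. indicator {t. \<bar>\<sigma> * t - c\<bar> \<le> \<delta>} t *\<^sub>R exp (- (\<bar>t\<bar> powr p) / p) \<partial>lborel) / exp_power_mass p"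
    using exp_power_mass_le[OF p] exp_power_mass_pos[OF p] \<sigma> \<delta> by (intro frac_le) auto
  moreover have "2 * \<delta> / \<sigma> * ?E / (2 * pi) = \<delta> / (\<sigma> * pi) * ?E" by simp
  ultimately have le: "\<delta> / (\<sigma> * pi) * ?E \<le> (\<integral>t. indicator {t. \<bar>\<sigma> * t - c\<bar> \<le> \<delta>} t *\<^sub>R exp (- (\<bar>t\<bar> powr p) / p) \<partial>lborel) / exp_power_mass p"
    by simp
  interpret prob_space "exp_power_law p" by (rule prob_space_exp_power_law) fact
  have "ennreal (\<delta> / (\<sigma> * pi) * ?E) \<le> ennreal (measure (exp_power_law p) {t. \<bar>\<sigma> * t - c\<bar> \<le> \<delta>})"
    unfolding emeasure_eq_measure[symmetric] 
    by (subst emeasure_exp_power_law[OF p], simp, rule ennreal_leI[OF le])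
  thus ?thesis by (simp add: ennreal_le_iff)
qed

section \<open>The prior as an infinite product: cylinders and boxes\<close>

lemma sets_exp_power_prior [measurable_cong]: "sets (exp_power_prior \<sigma> p) = sets seq_space"
  by (simp add: exp_power_prior_def)

lemma space_exp_power_prior: "space (exp_power_prior \<sigma> p) = space seq_space"
  by (simp add: exp_power_prior_def)

lemma measurable_prior_scale:
  "(\<lambda>\<zeta>. \<lambda>k\<in>{1..}. \<sigma> k * \<zeta> k) \<in> Pi\<^sub>M {1..} (\<lambda>k. exp_power_law (p k)) \<rightarrow>\<^sub>M seq_space"
proof -
  have [measurable_cong]: "sets (Pi\<^sub>M {1..} (\<lambda>k. exp_power_law (p k))) = sets seq_space"
    by (rule sets_PiM_cong) auto
  show ?thesis by measurable
qed

lemma prob_space_exp_power_prior: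
  assumes "\<And>k. k \<ge> 1 \<Longrightarrow> p k > 0"
  shows "prob_space (exp_power_prior \<sigma> p)"
  unfolding exp_power_prior_def using assms
  by (intro prob_space.prob_space_distr prob_space_PiM prob_space_exp_power_law measurable_prior_scale) auto

lemma measure_exp_power_prior_cylinder:
  assumes p: "\<And>k. k \<ge> 1 \<Longrightarrow> p k > 0" and J: "finite J" "J \<subseteq> {1..}"
    and A [measurable]: "\<And>k. A k \<in> sets borel"
  shows "measure (exp_power_prior \<sigma> p) {f \<in> space seq_space. \<forall>k\<in>J. f k \<in> A k}
       = (\<Prod>k\<in>J. measure (exp_power_law (p k)) {t. \<sigma> k * t \<in> A k})"
proof -
  let ?M = "\<lambda>k. exp_power_law (p k)" and ?T = "\<lambda>\<zeta>. \<lambda>k\<in>{1..}. \<sigma> k * \<zeta> k"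
  interpret Q: prob_space "exp_power_prior \<sigma> p" using p by (rule prob_space_exp_power_prior)
  have [measurable]: "{t. \<sigma> k * t \<in> A k} \<in> sets borel" for k
  proof -
    have "(\<lambda>t. \<sigma> k * t) -` A k \<inter> space borel \<in> sets borel" by measurable
    thus ?thesis by (simp add: vimage_def)
  qed
  have J1: "Suc 0 \<le> k" if "k \<in> J" for k using J that by auto
  have "?T -` {f \<in> space seq_space. \<forall>k\<in>J. f k \<in> A k} \<inter> space (Pi\<^sub>M {1..} ?M)
      = prod_emb {1..} ?M J (Pi\<^sub>E J (\<lambda>k. {t. \<sigma> k * t \<in> A k}))"
    using J1 by (auto simp: prod_emb_def space_PiM PiE_iff extensional_def)
  hence "emeasure (exp_power_prior \<sigma> p) {f \<in> space seq_space. \<forall>k\<in>J. f k \<in> A k}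
      = emeasure (Pi\<^sub>M {1..} ?M) (prod_emb {1..} ?M J (Pi\<^sub>E J (\<lambda>k. {t. \<sigma> k * t \<in> A k})))"
    unfolding exp_power_prior_def using J
    by (subst emeasure_distr[OF measurable_prior_scale]) (auto intro!: sets.sets_Collect_finite_All)
  also have "\<dots> = (\<Prod>k\<in>J. emeasure (?M k) {t. \<sigma> k * t \<in> A k})"
    using J p by (intro emeasure_PiM_emb prob_space_exp_power_law) auto
  also have "\<dots> = (\<Prod>k\<in>J. ennreal (measure (?M k) {t. \<sigma> k * t \<in> A k}))"
  proof (rule prod.cong)
    fix k assume "k \<in> J"
    then interpret prob_space "?M k" using J p by (intro prob_space_exp_power_law) auto
    show "emeasure (?M k) {t. \<sigma> k * t \<in> A k} = ennreal (measure (?M k) {t. \<sigma> k * t \<in> A k})"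
      by (rule emeasure_eq_measure)
  qed simp
  also have "\<dots> = ennreal (\<Prod>k\<in>J. measure (?M k) {t. \<sigma> k * t \<in> A k})"
    by (rule prod_ennreal) simp
  finally show ?thesis by (simp add: Q.emeasure_eq_measure prod_nonneg)
qed

definition seq_box :: "(nat \<Rightarrow> real) \<Rightarrow> (nat \<Rightarrow> real) \<Rightarrow> (nat \<Rightarrow> real) set" where
  "seq_box c \<delta> = {f \<in> space seq_space. \<forall>k\<ge>1. \<bar>f k - c k\<bar> \<le> \<delta> k}"

lemma sets_seq_box [measurable]: "seq_box c \<delta> \<in> sets seq_space"
proof -
  have "seq_box c \<delta> = {f \<in> space seq_space. \<forall>k. \<bar>f (Suc k) - c (Suc k)\<bar> \<le> \<delta> (Suc k)}"
    unfolding seq_box_def by (auto simp: le_iff_add)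
  also have "\<dots> \<in> sets seq_space" by measurable
  finally show ?thesis .
qed

text \<open>Continuity from above along the cylinders on the first \<open>m\<close> coordinates; a
  bound uniform in \<open>m\<close> survives the limit.\<close>

lemma measure_seq_box_ge:
  assumes p: "\<And>k. k \<ge> 1 \<Longrightarrow> p k > 0"
    and le: "\<And>m. B \<le> (\<Prod>k=1..m. measure (exp_power_law (p k)) {t. \<bar>\<sigma> k * t - c k\<bar> \<le> \<delta> k})"
  shows "B \<le> measure (exp_power_prior \<sigma> p) (seq_box c \<delta>)"
proof -
  interpret Q: prob_space "exp_power_prior \<sigma> p" using p by (rule prob_space_exp_power_prior)
  let ?A = "\<lambda>k. {x. \<bar>x - c k\<bar> \<le> \<delta> k}"
  let ?K = "\<lambda>m. {f \<in> space seq_space. \<forall>k\<in>{1..m}. f k \<in> ?A k}"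
  have A: "?A k \<in> sets borel" for k by measurable
  have K: "?K m \<in> sets seq_space" for m by (intro sets.sets_Collect_finite_All) auto
  have "(\<lambda>m. measure (exp_power_prior \<sigma> p) (?K m)) \<longlonglongrightarrow> measure (exp_power_prior \<sigma> p) (\<Inter>m. ?K m)"
    using K by (intro Q.finite_Lim_measure_decseq) (auto simp: decseq_def sets_exp_power_prior)
  moreover have "(\<Inter>m. ?K m) = seq_box c \<delta>"
  proof (intro set_eqI iffI)
    fix f assume f: "f \<in> (\<Inter>m. ?K m)"
    have "\<bar>f k - c k\<bar> \<le> \<delta> k" if "k \<ge> 1" for k
    proof -
      from f have "f \<in> ?K k" by blast
      thus ?thesis using that by simp
    qed
    thus "f \<in> seq_box c \<delta>" using f unfolding seq_box_def by blast
  qed (simp add: seq_box_def)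
  moreover have "B \<le> measure (exp_power_prior \<sigma> p) (?K m)" for m
    using le[of m] by (subst measure_exp_power_prior_cylinder[OF p _ _ A]) auto
  ultimately show ?thesis by (intro LIMSEQ_le_const) auto
qed

section \<open>Prior mass around the truth\<close>

lemma poly_decay_if_eventually:
  assumes "\<forall>\<^sub>F k in sequentially. \<bar>a (Suc k)\<bar> \<le> C * real (Suc k) powr (-b-1/2)"
  shows "poly_decay b a"
proof -
  from assms obtain N where N: "\<And>k. k \<ge> N \<Longrightarrow> \<bar>a (Suc k)\<bar> \<le> C * real (Suc k) powr (-b-1/2)"
    unfolding eventually_sequentially by blast
  \<comment> \<open>The finitely many coordinates outside the asymptotic bound are absorbed by
    weighting them with the inverse of the decay rate.\<close>
  define C' where "C' = \<bar>C\<bar> + (\<Sum>j\<le>N. \<bar>a j\<bar> * real j powr (b+1/2))"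
  have "\<bar>a k\<bar> \<le> C' * real k powr (-b-1/2)" if k: "k \<ge> 1" for k
  proof (cases "k \<le> N")
    case True
    have "\<bar>a k\<bar> = (\<bar>a k\<bar> * real k powr (b+1/2)) * real k powr (-b-1/2)"
      using k by (simp add: powr_add[symmetric] mult.assoc)
    also have "\<bar>a k\<bar> * real k powr (b+1/2) \<le> (\<Sum>j\<le>N. \<bar>a j\<bar> * real j powr (b+1/2))"
      using True by (intro member_le_sum) auto
    hence "(\<bar>a k\<bar> * real k powr (b+1/2)) * real k powr (-b-1/2) \<le> C' * real k powr (-b-1/2)"
      unfolding C'_def by (intro mult_right_mono) auto
    finally show ?thesis .
  next
    case False
    hence "\<bar>a k\<bar> \<le> C * real k powr (-b-1/2)" using N[of "k - 1"] k by simp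
    also have "\<dots> \<le> C' * real k powr (-b-1/2)"
      unfolding C'_def by (intro mult_right_mono) (auto intro!: add_increasing2 sum_nonneg)
    finally show ?thesis .
  qed
  thus ?thesis unfolding poly_decay_def by blast
qed

lemma ratio_seq_pos: "k \<ge> 1 \<Longrightarrow> \<sigma> k > 0 \<Longrightarrow> ratio_seq \<beta> \<sigma> k > 0"
  by (simp add: ratio_seq_def)

lemma scale_mult_ratio_seq: "\<sigma> k > 0 \<Longrightarrow> \<sigma> k * ratio_seq \<beta> \<sigma> k = real k powr (-\<beta>-1/2)"
  by (simp add: ratio_seq_def)

text \<open>Borel-Cantelli: on the scale of the standardised coordinate the threshold
  \<open>k powr (- \<beta> - 1/2)\<close> is \<open>ratio_seq \<beta> \<sigma> k\<close>, so the
  tail bound makes the exceedance probabilities summable. The finitely many exceedances only enlarge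
  the random constant.\<close>

lemma AE_exp_power_prior_poly_decay:
  assumes \<sigma>: "\<And>k. k \<ge> 1 \<Longrightarrow> \<sigma> k > 0"
    and p: "\<And>k. k \<ge> 1 \<Longrightarrow> 0 < p k \<and> p k \<le> 1"
    and r: "\<And>k. k > k0 \<Longrightarrow> ratio_seq \<beta> \<sigma> k powr p k \<ge> 8"
    and sm: "summable (\<lambda>k. exp (- z_seq \<beta> \<sigma> p (Suc k) / 4))"
  shows "AE f in exp_power_prior \<sigma> p. poly_decay \<beta> f"
proof -
  interpret Q: prob_space "exp_power_prior \<sigma> p" using p by (intro prob_space_exp_power_prior) auto
  let ?w = "\<lambda>k. real (Suc k) powr (-\<beta>-1/2)"
  define A where "A k = {f \<in> space seq_space. \<bar>f (Suc k)\<bar> > ?w k}" for k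
  have A [measurable]: "A k \<in> sets seq_space" for k unfolding A_def by measurable
  have PA: "measure (exp_power_prior \<sigma> p) (A k) \<le> 8/3 * exp (- z_seq \<beta> \<sigma> p (Suc k) / 4)" if "k \<ge> k0" for k
  proof -
    have sg: "\<sigma> (Suc k) > 0" using \<sigma> by simp
    have "measure (exp_power_prior \<sigma> p) (A k)
        = measure (exp_power_prior \<sigma> p) {f \<in> space seq_space. \<forall>j\<in>{Suc k}. f j \<in> {x. \<bar>x\<bar> > ?w k}}"
      unfolding A_def by simp
    also have "\<dots> = (\<Prod>j\<in>{Suc k}. measure (exp_power_law (p j)) {t. \<sigma> j * t \<in> {x. \<bar>x\<bar> > ?w k}})"
      using p by (intro measure_exp_power_prior_cylinder) auto
    also have "\<dots> = measure (exp_power_law (p (Suc k))) {t. \<bar>t\<bar> > ratio_seq \<beta> \<sigma> (Suc k)}"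
    proof -
      have "?w k < \<bar>\<sigma> (Suc k) * t\<bar> \<longleftrightarrow> ratio_seq \<beta> \<sigma> (Suc k) < \<bar>t\<bar>" for t
        unfolding scale_mult_ratio_seq[of \<sigma> "Suc k" \<beta>, OF sg, symmetric]
        using sg by (simp add: abs_mult)
      thus ?thesis by simp
    qed
    also have "\<dots> \<le> 8/3 * exp (- z_seq \<beta> \<sigma> p (Suc k) / 4)"
      unfolding z_seq_def using p[of "Suc k"] r[of "Suc k"] that ratio_seq_pos[of "Suc k" \<sigma> \<beta>] sg
      by (intro exp_power_law_tail) auto
    finally show ?thesis .
  qed
  have "summable (\<lambda>k. measure (exp_power_prior \<sigma> p) (A k))"
  proof (rule summable_comparison_test_ev[OF _ summable_mult[OF sm, of "8/3"]])
    show "\<forall>\<^sub>F k in sequentially. norm (measure (exp_power_prior \<sigma> p) (A k)) \<le> 8/3 * exp (- z_seq \<beta> \<sigma> p (Suc k) / 4)"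
      using eventually_ge_at_top[of k0] by eventually_elim (use PA in auto)
  qed
  hence "AE f in exp_power_prior \<sigma> p. \<forall>\<^sub>F k in sequentially. f \<in> space (exp_power_prior \<sigma> p) - A k"
    by (intro borel_cantelli_AE1) (use A in \<open>auto simp: sets_exp_power_prior Q.emeasure_eq_measure\<close>)
  thus ?thesis
  proof eventually_elim
    case (elim f)
    thus ?case
      by (intro poly_decay_if_eventually[where C = 1])
        (auto elim!: eventually_mono simp: A_def space_exp_power_prior)
  qed
qed

text \<open>Integral comparison for one term, by the mean value theorem, in a form that
  telescopes.\<close>

lemma powr_telescope_bound:
  fixes a x :: real
  assumes a: "a > 0" and x: "x > 0"
  shows "(x + 1) powr (- a - 1) \<le> (x powr (- a) - (x + 1) powr (- a)) / a"
proof -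
  have "\<exists>z. z > x \<and> z < x + 1 \<and> (x + 1) powr (- a) - x powr (- a) = (x + 1 - x) * ((- a) * z powr (- a - 1))"
    using x by (intro MVT2) (auto intro!: derivative_eq_intros simp: powr_diff)
  then obtain z where z: "z > x" "z < x + 1"
    "(x + 1) powr (- a) - x powr (- a) = - a * z powr (- a - 1)" by auto
  have "(x + 1) powr (- a - 1) \<le> z powr (- a - 1)"
    using a x z by (intro powr_mono2') auto
  also have "\<dots> = (x powr (- a) - (x + 1) powr (- a)) / a"
    using a z(3) by (simp add: eq_divide_eq algebra_simps)
  finally show ?thesis .
qed

lemma sum_powr_tail_le:
  fixes a :: real and N m :: nat
  assumes a: "a > 0" and N: "N \<ge> 1"
  shows "(\<Sum>k\<in>{N<..m}. real k powr (- a - 1)) \<le> real N powr (- a) / a"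
proof (cases "N \<le> m")
  case True
  have "(\<Sum>k\<in>{N<..m}. real k powr (- a - 1)) \<le> (real N powr (- a) - real m powr (- a)) / a"
    using True
  proof (induction m rule: dec_induct)
    case (step m)
    have "{N<..Suc m} = insert (Suc m) {N<..m}" using step by auto
    moreover have "(real m + 1) powr (- a - 1) \<le> (real m powr (- a) - (real m + 1) powr (- a)) / a"
      using step N by (intro powr_telescope_bound a) auto
    ultimately show ?case using step.IH by (simp add: diff_divide_distrib add.commute)
  qed simp
  also have "\<dots> \<le> real N powr (- a) / a" using a by (intro divide_right_mono) auto
  finally show ?thesis .
next
  case False
  thus ?thesis using a by simp
qed

text \<open>The box in which the prior mass is bounded from below: around \<open>f0\<close> up to frequency \<open>N\<close>,
  and around \<open>0\<close>, where the prior puts almost all its mass, beyond.\<close>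

definition sieve_center :: "(nat \<Rightarrow> real) \<Rightarrow> nat \<Rightarrow> nat \<Rightarrow> real" where
  "sieve_center f0 N k = (if k \<le> N then f0 k else 0)"

text \<open>With a constant radius up to \<open>N\<close>, the first \<open>N\<close> squared errors
  add up to \<open>N powr (- 2 * \<beta>)\<close>, the same order as the sum of
  \<open>k powr (- 2 * \<beta> - 1)\<close> beyond \<open>N\<close>.\<close>

definition sieve_radius :: "real \<Rightarrow> nat \<Rightarrow> nat \<Rightarrow> real" where
  "sieve_radius \<beta> N k = real (max N k) powr (-\<beta>-1/2)"

abbreviation sieve_box :: "real \<Rightarrow> (nat \<Rightarrow> real) \<Rightarrow> nat \<Rightarrow> (nat \<Rightarrow> real) set" where
  "sieve_box \<beta> f0 N \<equiv> seq_box (sieve_center f0 N) (sieve_radius \<beta> N)"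

lemma hyperrectangle_abs_le:
  assumes "f0 \<in> hyperrectangle \<beta> L" "k \<ge> 1"
  shows "\<bar>f0 k\<bar> \<le> L * real k powr (-\<beta>-1/2)"
proof -
  have "\<bar>f0 k\<bar> = (\<bar>f0 k\<bar> * real k powr (\<beta> + 1/2)) * real k powr (-\<beta>-1/2)"
    using assms by (simp add: mult.assoc powr_add[symmetric])
  also have "\<dots> \<le> L * real k powr (-\<beta>-1/2)"
    using assms unfolding hyperrectangle_def by (intro mult_right_mono) auto
  finally show ?thesis .
qed

lemma hyperrectangle_poly_decay: "f0 \<in> hyperrectangle \<beta> L \<Longrightarrow> poly_decay \<beta> f0"
  unfolding poly_decay_def using hyperrectangle_abs_le by blast

text \<open>Beyond \<open>N\<close> the box does not follow \<open>f0\<close>: the error is that of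
  \<open>f\<close> plus the whole of \<open>f0 k\<close>, hence the factor
  \<open>1 + L\<close>.\<close>

lemma sieve_box_abs_diff_le:
  assumes f0: "f0 \<in> hyperrectangle \<beta> L" and f: "f \<in> sieve_box \<beta> f0 N" and k: "k \<ge> 1"
  shows "k \<le> N \<Longrightarrow> \<bar>f k - f0 k\<bar> \<le> real N powr (-\<beta>-1/2)"
    and "k > N \<Longrightarrow> \<bar>f k - f0 k\<bar> \<le> (1 + L) * real k powr (-\<beta>-1/2)"
proof -
  have *: "\<bar>f k - sieve_center f0 N k\<bar> \<le> sieve_radius \<beta> N k"
    using f k unfolding seq_box_def by blast
  show "\<bar>f k - f0 k\<bar> \<le> real N powr (-\<beta>-1/2)" if "k \<le> N"
    using * that by (simp add: sieve_center_def sieve_radius_def max_absorb1)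
  show "\<bar>f k - f0 k\<bar> \<le> (1 + L) * real k powr (-\<beta>-1/2)" if "k > N"
  proof -
    have "\<bar>f k\<bar> \<le> real k powr (-\<beta>-1/2)"
      using * that by (simp add: sieve_center_def sieve_radius_def max_absorb2)
    with hyperrectangle_abs_le[OF f0 k] show ?thesis by (simp add: distrib_right)
  qed
qed

lemma sieve_box_poly_decay:
  assumes "f \<in> sieve_box \<beta> f0 N"
  shows "poly_decay \<beta> f"
proof (rule poly_decay_if_eventually[where C = 1])
  show "\<forall>\<^sub>F k in sequentially. \<bar>f (Suc k)\<bar> \<le> 1 * real (Suc k) powr (-\<beta>-1/2)"
    using eventually_ge_at_top[of N]
  proof eventually_elim
    case (elim k)
    have "\<bar>f (Suc k) - sieve_center f0 N (Suc k)\<bar> \<le> sieve_radius \<beta> N (Suc k)"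
      using assms unfolding seq_box_def by auto
    thus ?case using elim by (simp add: sieve_center_def sieve_radius_def max_absorb2)
  qed
qed

lemma sieve_box_dist_le:
  assumes b: "\<beta> > 0" and f0: "f0 \<in> hyperrectangle \<beta> L"
    and f: "f \<in> sieve_box \<beta> f0 N" and N: "N \<ge> 1"
  shows "(\<Sum>k. (f (Suc k) - f0 (Suc k))\<^sup>2) \<le> (1 + (1 + L)\<^sup>2 / (2 * \<beta>)) * real N powr (-2 * \<beta>)"
proof (rule suminf_le_const)
  have d: "poly_decay \<beta> (\<lambda>k. f k - f0 k)"
    by (intro poly_decay_diff sieve_box_poly_decay[OF f] hyperrectangle_poly_decay[OF f0])
  show "summable (\<lambda>k. (f (Suc k) - f0 (Suc k))\<^sup>2)"
    using poly_decay_summable_mult[OF b d d] by (simp add: power2_eq_square)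
  fix m
  have sq: "(real k powr (-\<beta>-1/2))\<^sup>2 = real k powr (- (2 * \<beta>) - 1)" for k
    by (simp add: power2_eq_square powr_add[symmetric])
  have "(\<Sum>k<m. (f (Suc k) - f0 (Suc k))\<^sup>2) = (\<Sum>k=1..m. (f k - f0 k)\<^sup>2)"
    by (rule sum_Suc_shift)
  also have "\<dots> \<le> (\<Sum>k\<in>{1..N} \<union> {N<..m}. (f k - f0 k)\<^sup>2)"
    by (intro sum_mono2) auto
  also have "\<dots> = (\<Sum>k\<in>{1..N}. (f k - f0 k)\<^sup>2) + (\<Sum>k\<in>{N<..m}. (f k - f0 k)\<^sup>2)"
    by (intro sum.union_disjoint) auto
  also have "(\<Sum>k\<in>{1..N}. (f k - f0 k)\<^sup>2) \<le> (\<Sum>k\<in>{1..N}. real N powr (- (2 * \<beta>) - 1))"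
  proof (rule sum_mono)
    fix k assume "k \<in> {1..N}"
    hence "\<bar>f k - f0 k\<bar> \<le> real N powr (-\<beta>-1/2)" by (intro sieve_box_abs_diff_le(1)[OF f0 f]) auto
    hence "\<bar>f k - f0 k\<bar>\<^sup>2 \<le> (real N powr (-\<beta>-1/2))\<^sup>2" by (intro power_mono) auto
    thus "(f k - f0 k)\<^sup>2 \<le> real N powr (- (2 * \<beta>) - 1)" by (simp add: sq)
  qed
  also have "\<dots> = real N powr (- 2 * \<beta>)"
    using N by (simp add: powr_diff)
  also have "(\<Sum>k\<in>{N<..m}. (f k - f0 k)\<^sup>2) \<le> (\<Sum>k\<in>{N<..m}. (1 + L)\<^sup>2 * real k powr (- (2 * \<beta>) - 1))"
  proof (rule sum_mono)
    fix k assume "k \<in> {N<..m}"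
    hence "\<bar>f k - f0 k\<bar> \<le> (1 + L) * real k powr (-\<beta>-1/2)" by (intro sieve_box_abs_diff_le(2)[OF f0 f]) auto
    hence "\<bar>f k - f0 k\<bar>\<^sup>2 \<le> ((1 + L) * real k powr (-\<beta>-1/2))\<^sup>2" by (intro power_mono) auto
    thus "(f k - f0 k)\<^sup>2 \<le> (1 + L)\<^sup>2 * real k powr (- (2 * \<beta>) - 1)" by (simp add: sq power_mult_distrib)
  qed
  also have "\<dots> = (1 + L)\<^sup>2 * (\<Sum>k\<in>{N<..m}. real k powr (- (2 * \<beta>) - 1))"
    by (simp add: sum_distrib_left)
  also have "\<dots> \<le> (1 + L)\<^sup>2 * (real N powr (- (2 * \<beta>)) / (2 * \<beta>))"
    using b N by (intro mult_left_mono sum_powr_tail_le) auto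
  finally show "(\<Sum>k<m. (f (Suc k) - f0 (Suc k))\<^sup>2) \<le> (1 + (1 + L)\<^sup>2 / (2 * \<beta>)) * real N powr (-2 * \<beta>)"
    by (simp add: distrib_right)
qed

text \<open>The exponent is a sum of coordinate costs. For \<open>k \<le> N\<close> the small ball
  bound costs \<open>A + (L + 1) * z k\<close>, where \<open>A\<close> pays for the prefactor; for
  \<open>k > N\<close> the central bound costs \<open>6 * exp (- z k / 4)\<close>. The lower bound
  \<open>r0\<close> keeps \<open>1 / \<sigma> k\<close>, and with it the prefactor, away from
  0.\<close>

lemma measure_sieve_box_ge:
  assumes b: "\<beta> > 0" and L: "L \<ge> 0" and f0: "f0 \<in> hyperrectangle \<beta> L"
    and \<sigma>: "\<And>k. k \<ge> 1 \<Longrightarrow> \<sigma> k > 0"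
    and p: "\<And>k. k \<ge> 1 \<Longrightarrow> 0 < p k \<and> p k \<le> 1"
    and r: "\<And>k. k > N \<Longrightarrow> ratio_seq \<beta> \<sigma> k powr p k \<ge> 8"
    and r0: "0 < r0" "r0 \<le> 1" "\<And>k. k \<ge> 1 \<Longrightarrow> r0 \<le> ratio_seq \<beta> \<sigma> k"
    and sm: "summable (\<lambda>k. exp (- z_seq \<beta> \<sigma> p (Suc k) / 4))"
    and N: "N \<ge> 1"
  shows "exp (- (real N * (2 - ln r0 + (\<beta> + 1/2) * ln (real N)) + (L + 1) * (\<Sum>k=1..N. z_seq \<beta> \<sigma> p k)
            + 6 * (\<Sum>k. exp (- z_seq \<beta> \<sigma> p (Suc k) / 4))))
       \<le> measure (exp_power_prior \<sigma> p) (sieve_box \<beta> f0 N)"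
proof (rule measure_seq_box_ge)
  let ?z = "z_seq \<beta> \<sigma> p" and ?r = "ratio_seq \<beta> \<sigma>"
  define A where "A = 2 - ln r0 + (\<beta> + 1/2) * ln (real N)"
  \<comment> \<open>The last term is charged at every frequency, also for \<open>k \<le> N\<close>,
    so that the total is bounded by one full series.\<close>
  define u where "u k = (if k \<le> N then A + (L + 1) * ?z k else 0) + 6 * exp (- ?z k / 4)" for k
  have A0: "A \<ge> 0"
  proof -
    have "ln r0 \<le> 0" using r0 by simp
    moreover have "(\<beta> + 1/2) * ln (real N) \<ge> 0" using b N by (intro mult_nonneg_nonneg) auto
    ultimately show ?thesis unfolding A_def by linarith
  qed
  have z0: "?z k \<ge> 0" if "k \<ge> 1" for k using p[OF that] by (simp add: z_seq_def)
  show "p k > 0" if "k \<ge> 1" for k using p that by auto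
  have q: "exp (- u k) \<le> measure (exp_power_law (p k)) {t. \<bar>\<sigma> k * t - sieve_center f0 N k\<bar> \<le> sieve_radius \<beta> N k}"
    if k: "k \<ge> 1" for k
  proof (cases "k \<le> N")
    case True
    let ?\<delta> = "real N powr (-\<beta>-1/2)"
    have sg: "\<sigma> k > 0" using \<sigma> k by auto
    have rp: "?r k > 0" using k sg by (intro ratio_seq_pos) auto
    have eqs: "sieve_center f0 N k = f0 k" "sieve_radius \<beta> N k = ?\<delta>"
      using True by (simp_all add: sieve_center_def sieve_radius_def max_absorb1)
    have "?\<delta> \<le> real k powr (-\<beta>-1/2)" using True k b by (intro powr_mono2') auto
    hence "\<bar>f0 k\<bar> + ?\<delta> \<le> (L + 1) * real k powr (-\<beta>-1/2)"
      using hyperrectangle_abs_le[OF f0 k] by (simp add: distrib_right)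
    hence "(\<bar>f0 k\<bar> + ?\<delta>) / \<sigma> k \<le> (L + 1) * real k powr (-\<beta>-1/2) / \<sigma> k"
      using sg by (intro divide_right_mono) auto
    hence "(\<bar>f0 k\<bar> + ?\<delta>) / \<sigma> k \<le> (L + 1) * ?r k"
      by (simp add: ratio_seq_def)
    hence "((\<bar>f0 k\<bar> + ?\<delta>) / \<sigma> k) powr p k \<le> ((L + 1) * ?r k) powr p k"
      using p[OF k] sg by (intro powr_mono2) auto
    also have "\<dots> = (L + 1) powr p k * ?r k powr p k" using L rp by (simp add: powr_mult)
    \<comment> \<open>Here \<open>p k \<le> 1\<close> lets \<open>L + 1\<close> leave the power at
      cost linear in \<open>L\<close>.\<close>
    also have "(L + 1) powr p k \<le> (L + 1) powr 1" using L p[OF k] by (intro powr_mono) auto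
    hence "(L + 1) powr p k * ?r k powr p k \<le> (L + 1) * ?r k powr p k"
      using L by (intro mult_right_mono) auto
    finally have "((\<bar>f0 k\<bar> + ?\<delta>) / \<sigma> k) powr p k / p k \<le> (L + 1) * ?r k powr p k / p k"
      using p[OF k] by (intro divide_right_mono) auto
    hence E: "((\<bar>f0 k\<bar> + ?\<delta>) / \<sigma> k) powr p k / p k \<le> (L + 1) * ?z k" by (simp add: z_seq_def)
    have "exp 1 \<ge> (2::real)" using exp_ge_add_one_self[of 1] by simp
    hence "2 * 2 \<le> exp 1 * exp (1::real)" by (intro mult_mono) auto
    hence "4 \<le> exp (2::real)" by (simp flip: exp_add)
    hence "exp (-2) \<le> (1/4::real)" by (simp add: exp_minus field_simps)
    also have "\<dots> \<le> 1 / pi" using pi_less_4 pi_gt_zero by (simp add: field_simps)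
    finally have epi: "exp (-2) \<le> 1 / pi" .
    have "real k powr (-\<beta>-1/2) \<le> 1" using k b powr_mono2'[of "-\<beta>-1/2" 1 "real k"] by simp
    hence "?r k \<le> 1 / \<sigma> k" unfolding ratio_seq_def using sg by (intro divide_right_mono) auto
    with r0(3)[OF k] have r0s: "r0 \<le> 1 / \<sigma> k" by linarith
    \<comment> \<open>The three factors are matched with \<open>1 / pi\<close>,
      \<open>1 / \<sigma> k\<close> and \<open>?\<delta>\<close> in the small ball
      prefactor.\<close>
    have "exp (- A) = exp (-2) * (r0 * ?\<delta>)"
    proof -
      have "- A = -2 + (ln r0 + (-\<beta>-1/2) * ln (real N))" unfolding A_def by (simp add: algebra_simps)
      thus ?thesis using r0 N by (simp only: exp_add) (simp add: powr_def)
    qed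
    also have "\<dots> \<le> (1 / pi) * ((1 / \<sigma> k) * ?\<delta>)"
      using epi r0s r0(1) sg by (intro mult_mono) auto
    finally have EA: "exp (- A) \<le> ?\<delta> / (\<sigma> k * pi)" by (simp add: mult.commute)
    have "exp (- u k) \<le> exp (- A + - ((L + 1) * ?z k))"
      unfolding u_def using True by simp
    also have "\<dots> = exp (- A) * exp (- ((L + 1) * ?z k))" by (rule exp_add)
    also have "\<dots> \<le> ?\<delta> / (\<sigma> k * pi) * exp (- (((\<bar>f0 k\<bar> + ?\<delta>) / \<sigma> k) powr p k / p k))"
      using EA E sg by (intro mult_mono) auto
    also have "\<dots> \<le> measure (exp_power_law (p k)) {t. \<bar>\<sigma> k * t - f0 k\<bar> \<le> ?\<delta>}"
      using p[OF k] sg by (intro exp_power_law_small_ball) auto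
    finally show ?thesis by (simp only: eqs)
  next
    case False
    hence eqs: "sieve_center f0 N k = 0" "sieve_radius \<beta> N k = \<sigma> k * ?r k"
      using scale_mult_ratio_seq[of \<sigma> k \<beta>] \<sigma>[OF k] by (simp_all add: sieve_center_def sieve_radius_def max_absorb2)
    have "exp (- u k) = exp (- 6 * exp (- (?r k powr p k / p k) / 4))"
      using False by (simp add: u_def z_seq_def)
    also have "\<dots> \<le> measure (exp_power_law (p k)) {t. \<bar>t\<bar> \<le> ?r k}"
      using p[OF k] r[of k] False ratio_seq_pos[where \<sigma> = \<sigma> and k = k and \<beta> = \<beta>, OF k \<sigma>[OF k]] by (intro exp_power_law_central) auto
    also have "{t. \<bar>t\<bar> \<le> ?r k} = {t. \<bar>\<sigma> k * t - 0\<bar> \<le> \<sigma> k * ?r k}"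
      using \<sigma>[OF k] by (simp add: abs_mult)
    finally show ?thesis by (simp only: eqs)
  qed
  fix m
  have "(\<Sum>k=1..m. u k) = (\<Sum>k=1..m. if k \<le> N then A + (L + 1) * ?z k else 0) + 6 * (\<Sum>k=1..m. exp (- ?z k / 4))"
    unfolding u_def by (simp add: sum.distrib sum_distrib_left)
  also have "(\<Sum>k=1..m. if k \<le> N then A + (L + 1) * ?z k else 0) = (\<Sum>k\<in>{1..m} \<inter> {..N}. A + (L + 1) * ?z k)"
    by (subst sum.inter_restrict) simp_all
  also have "\<dots> \<le> (\<Sum>k=1..N. A + (L + 1) * ?z k)"
    using A0 z0 L by (intro sum_mono2) auto
  also have "\<dots> = real N * A + (L + 1) * (\<Sum>k=1..N. ?z k)"
    by (simp add: sum.distrib sum_distrib_left)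
  also have "(\<Sum>k=1..m. exp (- ?z k / 4)) \<le> (\<Sum>k. exp (- ?z (Suc k) / 4))"
    unfolding sum_Suc_shift[of "\<lambda>k. exp (- ?z k / 4)", symmetric]
    by (intro sum_le_suminf sm) auto
  finally have "(\<Sum>k=1..m. u k) \<le> real N * A + (L + 1) * (\<Sum>k=1..N. ?z k) + 6 * (\<Sum>k. exp (- ?z (Suc k) / 4))"
    by simp
  hence "exp (- (real N * A + (L + 1) * (\<Sum>k=1..N. ?z k) + 6 * (\<Sum>k. exp (- ?z (Suc k) / 4))))
      \<le> exp (- (\<Sum>k=1..m. u k))" by simp
  also have "\<dots> = (\<Prod>k=1..m. exp (- u k))" by (simp add: exp_sum flip: sum_negf)
  also have "\<dots> \<le> (\<Prod>k=1..m. measure (exp_power_law (p k)) {t. \<bar>\<sigma> k * t - sieve_center f0 N k\<bar> \<le> sieve_radius \<beta> N k})"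
    by (intro prod_mono) (use q in auto)
  finally show "exp (- (real N * (2 - ln r0 + (\<beta> + 1/2) * ln (real N)) + (L + 1) * (\<Sum>k=1..N. ?z k)
            + 6 * (\<Sum>k. exp (- ?z (Suc k) / 4))))
      \<le> (\<Prod>k=1..m. measure (exp_power_law (p k)) {t. \<bar>\<sigma> k * t - sieve_center f0 N k\<bar> \<le> sieve_radius \<beta> N k})"
    unfolding A_def .
qed

section \<open>Bound on the expected posterior mass\<close>

text \<open>The ratio \<open>N/D\<close> of the mass outside \<open>B\<close> to the total mass is at most 1 and, by AM-GM on \<open>K\<close>,
  at most \<open>N V / measure Q K ^ 2\<close> where \<open>V\<close> integrates \<open>1/h\<close> over \<open>K\<close>; splitting this product with a
  weight \<open>\<tau>\<close> leaves a bound that is linear in \<open>N\<close> and \<open>V\<close>, so that no lower bound in probability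
  for the denominator is needed.\<close>

lemma integral_ratio_compl_le:
  assumes Q: "prob_space Q" and h [measurable]: "h \<in> borel_measurable Q"
    and pos: "\<And>f. h f > 0" and int: "integrable Q h"
    and B [measurable]: "B \<in> sets Q" and K [measurable]: "K \<in> sets Q"
    and K0: "measure Q K > 0" and \<tau>: "\<tau> > 0"
  defines "R \<equiv> (LINT f:B|Q. h f) / (LINT f|Q. h f)"
  shows "0 \<le> R" "R \<le> 1"
    "ennreal (1 - R) \<le> ennreal \<tau> * (\<integral>\<^sup>+f. ennreal (h f) * indicator (space Q - B) f \<partial>Q)
        + ennreal (1 / (\<tau> * (measure Q K)\<^sup>2)) * (\<integral>\<^sup>+f. ennreal (1 / h f) * indicator K f \<partial>Q)"
proof -
  interpret prob_space Q by fact
  define D where "D = (LINT f|Q. h f)"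
  define N where "N = (LINT f:space Q - B|Q. h f)"
  define q where "q = measure Q K"
  have setint: "set_integrable Q A h" if "A \<in> sets Q" for A
    unfolding set_integrable_def using that int by (intro integrable_mult_indicator)
  have D: "D > 0"
  proof -
    have "(LINT f|Q. 0) < (LINT f|Q. h f)"
      using pos int by (intro integral_less_AE_space) (auto simp: emeasure_space_1)
    thus ?thesis by (simp add: D_def)
  qed
  have split: "(LINT f:B|Q. h f) + N = D"
  proof -
    have "(LINT f:B \<union> (space Q - B)|Q. h f) = (LINT f:B|Q. h f) + N"
      unfolding N_def by (intro set_integral_Un setint) auto
    moreover have "B \<union> (space Q - B) = space Q" using sets.sets_into_space[OF B] by auto
    moreover have "(LINT f:space Q|Q. h f) = D"
      unfolding D_def by (rule set_integral_space) (rule int)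
    ultimately show ?thesis by simp
  qed
  have B0: "(LINT f:B|Q. h f) \<ge> 0"
    unfolding set_lebesgue_integral_def by (intro integral_nonneg_AE) (simp add: pos less_imp_le)
  have N0: "N \<ge> 0"
    unfolding N_def set_lebesgue_integral_def by (intro integral_nonneg_AE) (simp add: pos less_imp_le)
  have R: "1 - R = N / D" using split D unfolding R_def D_def[symmetric] by (simp add: field_simps)
  show "0 \<le> R" unfolding R_def D_def[symmetric] using B0 D by simp
  show R1: "R \<le> 1" using R N0 D by (smt (verit) divide_nonneg_nonneg)
  have Neq: "(\<integral>\<^sup>+f. ennreal (h f) * indicator (space Q - B) f \<partial>Q) = ennreal N"
  proof -
    have "(\<integral>\<^sup>+f. ennreal (indicator (space Q - B) f *\<^sub>R h f) \<partial>Q) = ennreal N"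
      unfolding N_def set_lebesgue_integral_def
      using setint[of "space Q - B"] pos unfolding set_integrable_def
      by (intro nn_integral_eq_integral) (simp_all add: pos less_imp_le)
    thus ?thesis by (subst (asm) nn_integral_cong[where v = "\<lambda>f. ennreal (h f) * indicator (space Q - B) f"])
        (auto split: split_indicator)
  qed
  let ?V = "\<integral>\<^sup>+f. ennreal (1 / h f) * indicator K f \<partial>Q"
  show "ennreal (1 - R) \<le> ennreal \<tau> * (\<integral>\<^sup>+f. ennreal (h f) * indicator (space Q - B) f \<partial>Q)
        + ennreal (1 / (\<tau> * (measure Q K)\<^sup>2)) * ?V"
  proof (cases "?V = \<infinity>")
    case True
    have "ennreal (1 / (\<tau> * (measure Q K)\<^sup>2)) \<noteq> 0" using K0 \<tau> by (simp add: ennreal_eq_0_iff not_le)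
    thus ?thesis unfolding True by (simp add: ennreal_mult_top)
  next
    case False
    have eqV: "?V = (\<integral>\<^sup>+f. ennreal (indicator K f * (1 / h f)) \<partial>Q)"
      by (intro nn_integral_cong) (auto split: split_indicator)
    have intV: "integrable Q (\<lambda>f. indicator K f * (1 / h f))"
      using False pos unfolding eqV by (intro integrableI_nonneg) (simp_all add: pos less_imp_le less_top)
    define V where "V = (LINT f|Q. indicator K f * (1 / h f))"
    have V: "?V = ennreal V"
      unfolding eqV V_def using pos by (intro nn_integral_eq_integral intV) (simp_all add: pos less_imp_le)
    have V0: "V \<ge> 0" unfolding V_def using pos by (intro integral_nonneg_AE) (simp_all add: pos less_imp_le)
    \<comment> \<open>Integrates \<open>2 \<le> x + 1 / x\<close> over \<open>K\<close> with
      \<open>x = (q / D) * h f\<close>. The scaling makes the first term integrate to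
      \<open>q\<close> over the whole space, which leaves the Cauchy-Schwarz inequality
      \<open>q\<^sup>2 \<le> D * V\<close>.\<close>
    have "2 * q \<le> (q / D) * D + V / (q / D)"
    proof -
      have "2 * q = (LINT f|Q. 2 * indicator K f)" by (simp add: q_def)
      also have "\<dots> \<le> (LINT f|Q. (q / D) * h f + (indicator K f * (1 / h f)) / (q / D))"
      proof (intro integral_mono)
        show "integrable Q (\<lambda>f. (q / D) * h f + (indicator K f * (1 / h f)) / (q / D))"
          using int intV by (intro Bochner_Integration.integrable_add integrable_mult_right integrable_divide) auto
        fix f
        let ?x = "(q / D) * h f"
        have x: "?x > 0" using K0 D pos[of f] by (simp add: q_def)
        have "2 \<le> y + 1 / y" if "y > 0" for y :: real
        proof -
          have "0 \<le> (y - 1)\<^sup>2 / y" using that by simp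
          also have "\<dots> = y + 1 / y - 2" using that by (simp add: power2_eq_square field_simps)
          finally show ?thesis by simp
        qed
        from this[OF x] have "2 \<le> ?x + 1 / ?x" .
        moreover have "1 / ?x = (1 / h f) / (q / D)" by simp
        ultimately show "2 * indicator K f \<le> ?x + (indicator K f * (1 / h f)) / (q / D)"
          using x by (auto simp: mult.commute split: split_indicator)
      qed (auto intro!: integrable_mult_right integrable_real_indicator simp: emeasure_eq_measure)
      also have "\<dots> = (q / D) * D + V / (q / D)"
      proof (subst Bochner_Integration.integral_add)
        show "integrable Q (\<lambda>f. (q / D) * h f)" by (intro integrable_mult_right int)
        show "integrable Q (\<lambda>f. indicator K f * (1 / h f) / (q / D))" by (intro integrable_divide intV)
        show "(LINT f|Q. (q / D) * h f) + (LINT f|Q. indicator K f * (1 / h f) / (q / D)) = (q / D) * D + V / (q / D)"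
          by (simp only: integral_mult_right_zero integral_divide_zero D_def[symmetric] V_def[symmetric])
      qed
      finally show ?thesis .
    qed
    hence "q\<^sup>2 \<le> D * V" using D K0 by (simp add: q_def power2_eq_square field_simps)
    hence "1 / D \<le> V / q\<^sup>2" using D K0 by (simp add: q_def field_simps)
    hence "N * (1 / D) \<le> N * (V / q\<^sup>2)" using N0 by (intro mult_left_mono)
    also have "\<dots> = (\<tau> * N) * (V / (\<tau> * q\<^sup>2))" using \<tau> by simp
    finally have ab: "1 - R \<le> (\<tau> * N) * (V / (\<tau> * q\<^sup>2))" by (simp add: R)
    have a0: "\<tau> * N \<ge> 0" using \<tau> N0 by simp
    have b0: "V / (\<tau> * q\<^sup>2) \<ge> 0" using \<tau> V0 by simp
    \<comment> \<open>With \<open>a\<close> and \<open>b\<close> the two summands,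
      \<open>min 1 (a * b) \<le> a + b\<close>: if \<open>a \<le> 1\<close> then
      \<open>a * b \<le> b\<close>, otherwise \<open>1 < a\<close>.\<close>
    have "1 - R \<le> \<tau> * N + V / (\<tau> * q\<^sup>2)"
    proof (cases "\<tau> * N \<le> 1")
      case True
      from mult_right_mono[OF this b0] ab a0 show ?thesis by linarith
    next
      case False
      thus ?thesis using \<open>0 \<le> R\<close> b0 by linarith
    qed
    hence "ennreal (1 - R) \<le> ennreal (\<tau> * N + V / (\<tau> * q\<^sup>2))" by (rule ennreal_leI)
    also have "\<dots> = ennreal \<tau> * ennreal N + ennreal (1 / (\<tau> * q\<^sup>2)) * ennreal V"
      using \<tau> N0 V0 a0 b0 by (simp add: ennreal_plus ennreal_mult'[symmetric])
    finally show ?thesis unfolding Neq V q_def .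
  qed
qed

section \<open>Measurability of the posterior and exchange of the integrals\<close>

lemma measurable_log_lik_compose [measurable (raw)]:
  assumes "f \<in> M \<rightarrow>\<^sub>M seq_space" "g \<in> M \<rightarrow>\<^sub>M seq_space"
  shows "(\<lambda>x. log_lik n (f x) (g x)) \<in> borel_measurable M"
  using measurable_compose[OF measurable_Pair[OF assms] measurable_log_lik] by simp

lemma sets_gauss_seq_model [measurable_cong]: "sets (gauss_seq_model n f) = sets seq_space"
  by (simp add: gauss_seq_model_def)

lemma prob_space_gauss_seq_model: "prob_space (gauss_seq_model n f)"
  unfolding gauss_seq_model_def
  by (intro prob_space.prob_space_distr prob_space_gauss_noise measurable_shift_scale)

text \<open>Tonelli. The bound on the inner expectation is required only for prior almost every
  \<open>f\<close>, which is exactly what almost sure polynomial decay supplies.\<close>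

lemma nn_integral_weighted_likelihood_le:
  assumes Q: "prob_space Q" and sQ [measurable_cong]: "sets Q = sets seq_space"
    and A [measurable]: "A \<in> sets seq_space"
    and le: "AE f in Q. f \<in> A \<longrightarrow>
      (\<integral>\<^sup>+X. ennreal (exp (s * (log_lik n f X - log_lik n f0 X))) \<partial>gauss_seq_model n f0) \<le> ennreal c"
  shows "(\<integral>\<^sup>+X. \<integral>\<^sup>+f. ennreal (exp (s * (log_lik n f X - log_lik n f0 X))) * indicator A f \<partial>Q \<partial>gauss_seq_model n f0)
       \<le> ennreal c * emeasure Q A"
proof -
  interpret Q: prob_space Q by fact
  interpret P: prob_space "gauss_seq_model n f0" by (rule prob_space_gauss_seq_model)
  interpret pair_sigma_finite Q "gauss_seq_model n f0" by unfold_locales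
  let ?g = "\<lambda>f X. ennreal (exp (s * (log_lik n f X - log_lik n f0 X)))"
  have ll [measurable]: "(\<lambda>X. log_lik n f X) \<in> borel_measurable seq_space" for f
    unfolding log_lik_def by measurable
  have "(\<integral>\<^sup>+X. \<integral>\<^sup>+f. ?g f X * indicator A f \<partial>Q \<partial>gauss_seq_model n f0)
      = (\<integral>\<^sup>+f. \<integral>\<^sup>+X. ?g f X * indicator A f \<partial>gauss_seq_model n f0 \<partial>Q)"
    by (rule Fubini') measurable
  also have "\<dots> = (\<integral>\<^sup>+f. (\<integral>\<^sup>+X. ?g f X \<partial>gauss_seq_model n f0) * indicator A f \<partial>Q)"
    by (intro nn_integral_cong nn_integral_multc) measurable
  also have "\<dots> \<le> (\<integral>\<^sup>+f. ennreal c * indicator A f \<partial>Q)"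
    using le by (intro nn_integral_mono_AE, eventually_elim) (auto split: split_indicator)
  also have "\<dots> = ennreal c * emeasure Q A"
    using A sQ by (intro nn_integral_cmult_indicator) auto
  finally show ?thesis .
qed

lemma sets_l2_cball: "l2_cball g e \<inter> space seq_space \<in> sets seq_space"
proof -
  have "l2_cball g e \<inter> space seq_space = {f \<in> space seq_space. summable (\<lambda>k. (f (Suc k) - g (Suc k))\<^sup>2)
      \<and> sqrt (\<Sum>k. (f (Suc k) - g (Suc k))\<^sup>2) \<le> e}"
    unfolding l2_cball_def l2_seq_def l2_norm_def by auto
  \<comment> \<open>Summability of nonnegative terms is finiteness of the extended series, a
    measurable condition.\<close>
  also have "\<dots> = {f \<in> space seq_space. (\<Sum>k. ennreal ((f (Suc k) - g (Suc k))\<^sup>2)) < \<infinity>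
      \<and> sqrt (\<Sum>k. (f (Suc k) - g (Suc k))\<^sup>2) \<le> e}"
    by (intro Collect_cong conj_cong refl iffI)
      (auto simp: suminf_ennreal2 less_top intro: summable_suminf_not_top)
  also have "\<dots> \<in> sets seq_space" by measurable
  finally show ?thesis .
qed

text \<open>A factor that depends on \<open>X\<close> alone cancels. With \<open>c\<close> the
  log-likelihood at \<open>f0\<close>, the posterior becomes a ratio of integrated likelihood
  ratios, whose moments are known.\<close>

lemma rho_posterior_eq_shifted:
  "rho_posterior \<rho> n Q X B =
     (LINT f:B|Q. exp (\<rho> * (log_lik n f X - c))) / (LINT f|Q. exp (\<rho> * (log_lik n f X - c)))"
proof -
  have *: "exp (\<rho> * log_lik n f X) = exp (\<rho> * c) * exp (\<rho> * (log_lik n f X - c))" for f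
    by (simp flip: exp_add add: algebra_simps)
  show ?thesis unfolding rho_posterior_def * by simp
qed

lemma borel_measurable_rho_posterior:
  assumes Q: "prob_space Q" and sQ [measurable_cong]: "sets Q = sets seq_space"
    and B [measurable]: "B \<in> sets seq_space"
  shows "(\<lambda>X. rho_posterior \<rho> n Q X B) \<in> borel_measurable seq_space"
proof -
  interpret prob_space Q by fact
  show ?thesis unfolding rho_posterior_def set_lebesgue_integral_def by measurable
qed

lemma rho_posterior_Int_space:
  "space Q = S \<Longrightarrow> rho_posterior \<rho> n Q X (B \<inter> S) = rho_posterior \<rho> n Q X B"
  unfolding rho_posterior_def set_lebesgue_integral_def
  by (intro arg_cong2[of _ _ _ _ "(/)"] Bochner_Integration.integral_cong) (auto simp: indicator_def)

text \<open>The moment bound is applied with power \<open>\<rho>\<close> on the complement of the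
  ball and with power \<open>- \<rho>\<close> on \<open>K\<close>. The latter integral is
  proportional to the mass of \<open>K\<close> and cancels one of the two factors
  \<open>measure Q K\<close>. The weight \<open>\<tau>\<close> stays free, to be balanced against
  that mass later.\<close>

lemma expectation_rho_posterior_ge:
  assumes Q: "prob_space Q" and sQ: "sets Q = sets seq_space"
    and decay: "AE f in Q. poly_decay b f" and b: "b > 0" and f0: "poly_decay b f0" and n: "n \<ge> 1"
    and \<rho>: "0 < \<rho>" "\<rho> < 1" and e: "e \<ge> 0" and \<tau>: "\<tau> > 0"
    and K: "K \<in> sets seq_space" and K0: "measure Q K > 0"
    and K_decay: "\<And>f. f \<in> K \<Longrightarrow> poly_decay b f"
    and K_dist: "\<And>f. f \<in> K \<Longrightarrow> real n * (\<Sum>k. (f (Suc k) - f0 (Suc k))\<^sup>2) \<le> \<kappa>"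
  defines "E \<equiv> LINT X|gauss_seq_model n f0. rho_posterior \<rho> n Q X (l2_cball f0 e)"
  shows "E \<le> 1"
    and "1 - E \<le> \<tau> * exp (- (\<rho> * (1 - \<rho>)) / 2 * (real n * e\<^sup>2)) + exp (\<rho> * (1 + \<rho>) / 2 * \<kappa>) / (\<tau> * measure Q K)"
proof -
  interpret Q: prob_space Q by fact
  interpret P: prob_space "gauss_seq_model n f0" by (rule prob_space_gauss_seq_model)
  note [measurable_cong] = sQ
  let ?P = "gauss_seq_model n f0"
  define B where "B = l2_cball f0 e \<inter> space seq_space"
  define \<Delta> where "\<Delta> f X = log_lik n f X - log_lik n f0 X" for f X
  define R where "R X = rho_posterior \<rho> n Q X B" for X
  have spQ: "space Q = space seq_space" using sQ by (rule sets_eq_imp_space_eq)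
  have B [measurable]: "B \<in> sets seq_space" unfolding B_def by (rule sets_l2_cball)
  have K' [measurable]: "K \<in> sets seq_space" by fact
  have ER: "E = (LINT X|?P. R X)"
    unfolding E_def R_def B_def rho_posterior_Int_space[OF spQ] ..
  have R_meas [measurable]: "R \<in> borel_measurable seq_space"
    unfolding R_def[abs_def] by (rule borel_measurable_rho_posterior[OF Q sQ B])
  have \<Delta>_meas: "(\<lambda>f. \<Delta> f X) \<in> borel_measurable seq_space" for X
    unfolding \<Delta>_def log_lik_def by measurable
  have ll [measurable]: "(\<lambda>X. log_lik n f X) \<in> borel_measurable seq_space" for f
    unfolding log_lik_def by measurable
  let ?I = "\<lambda>s A X. \<integral>\<^sup>+f. ennreal (exp (s * \<Delta> f X)) * indicator A f \<partial>Q"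
  have I_meas [measurable]: "(\<lambda>X. ?I s A X) \<in> borel_measurable ?P" if [measurable]: "A \<in> sets seq_space" for s A
    unfolding \<Delta>_def by measurable
  have I_le: "(\<integral>\<^sup>+X. ?I s A X \<partial>?P) \<le> ennreal c * emeasure Q A"
    if A: "A \<in> sets seq_space"
      and "AE f in Q. f \<in> A \<longrightarrow> - (s * (1 - s)) / 2 * (real n * (\<Sum>k. (f (Suc k) - f0 (Suc k))\<^sup>2)) \<le> ln c"
      and c: "c > 0" for s A c
    unfolding \<Delta>_def
  proof (rule nn_integral_weighted_likelihood_le[OF Q sQ A])
    from decay that(2) show "AE f in Q. f \<in> A \<longrightarrow>
      (\<integral>\<^sup>+X. ennreal (exp (s * (log_lik n f X - log_lik n f0 X))) \<partial>?P) \<le> ennreal c"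
    proof eventually_elim
      case (elim f)
      show ?case
      proof
        assume "f \<in> A"
        have "(\<integral>\<^sup>+X. ennreal (exp (s * (log_lik n f X - log_lik n f0 X))) \<partial>?P)
          \<le> ennreal (exp (- (s * (1 - s)) / 2 * (real n * (\<Sum>k. (f (Suc k) - f0 (Suc k))\<^sup>2))))"
          by (rule nn_integral_exp_log_lik_diff_le[OF b elim(1) f0 n])
        also have "\<dots> \<le> ennreal (exp (ln c))"
          using elim(2) \<open>f \<in> A\<close> by (intro ennreal_leI) simp
        finally show "(\<integral>\<^sup>+X. ennreal (exp (s * (log_lik n f X - log_lik n f0 X))) \<partial>?P) \<le> ennreal c"
          using c by simp
      qed
    qed
  qed
  have sq0: "(\<Sum>k. (f (Suc k) - f0 (Suc k))\<^sup>2) \<ge> 0" if "poly_decay b f" for f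
  proof -
    have d: "poly_decay b (\<lambda>k. f k - f0 k)" by (rule poly_decay_diff[OF that f0])
    show ?thesis using poly_decay_summable_mult[OF b d d] by (intro suminf_nonneg) (auto simp: power2_eq_square)
  qed
  have c\<rho>: "\<rho> * (1 - \<rho>) / 2 \<ge> 0" using \<rho> by simp
  \<comment> \<open>Power \<open>\<rho>\<close> on the whole space shows that the normalising
    integral is finite for almost every \<open>X\<close>. This is needed because a nonintegrable
    function has Bochner integral 0.\<close>
  have "(\<integral>\<^sup>+X. ?I \<rho> (space seq_space) X \<partial>?P) \<le> ennreal 1 * emeasure Q (space seq_space)"
    using decay by (intro I_le; (simp; fail)?; eventually_elim) (use c\<rho> sq0 in \<open>auto intro!: mult_nonneg_nonneg\<close>)
  also have "\<dots> = 1" using Q.emeasure_space_1 spQ by simp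
  finally have "(\<integral>\<^sup>+X. ?I \<rho> (space seq_space) X \<partial>?P) \<noteq> \<infinity>" by (auto simp: top_unique)
  hence "AE X in ?P. ?I \<rho> (space seq_space) X \<noteq> \<infinity>"
    by (intro nn_integral_PInf_AE) measurable
  hence AE_R: "AE X in ?P. 0 \<le> R X \<and> R X \<le> 1 \<and>
     ennreal (1 - R X) \<le> ennreal \<tau> * ?I \<rho> (space seq_space - B) X
        + ennreal (1 / (\<tau> * (measure Q K)\<^sup>2)) * ?I (- \<rho>) K X"
  proof eventually_elim
    case (elim X)
    let ?h = "\<lambda>f. exp (\<rho> * \<Delta> f X)"
    have hm: "?h \<in> borel_measurable Q" using \<Delta>_meas[of X] by measurable
    have "(\<integral>\<^sup>+f. ennreal (?h f) \<partial>Q) = ?I \<rho> (space seq_space) X"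
      by (intro nn_integral_cong) (auto simp: spQ)
    hence "integrable Q ?h" using elim hm by (intro integrableI_nonneg) (auto simp: less_top)
    from integral_ratio_compl_le[OF Q hm _ this, of B K \<tau>] B K K0 \<tau>
    show ?case
      unfolding R_def rho_posterior_eq_shifted[of _ _ _ _ _ "log_lik n f0 X"] \<Delta>_def[symmetric] spQ
      by (simp add: sQ exp_minus inverse_eq_divide)
  qed
  have R0: "AE X in ?P. 0 \<le> R X" and R1: "AE X in ?P. R X \<le> 1"
    using AE_R by (eventually_elim; blast)+
  have "AE X in ?P. norm (R X) \<le> 1" using AE_R by eventually_elim auto
  hence intR: "integrable ?P R"
    by (rule P.integrable_const_bound) measurable
  show "E \<le> 1"
  proof -
    have "E \<le> (LINT X|?P. 1)"
      unfolding ER using R1 intR by (intro integral_mono_AE) auto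
    thus ?thesis by (simp add: P.prob_space)
  qed
  let ?a = "exp (- (\<rho> * (1 - \<rho>)) / 2 * (real n * e\<^sup>2))" and ?b = "exp (\<rho> * (1 + \<rho>) / 2 * \<kappa>)"
  have N_le: "(\<integral>\<^sup>+X. ?I \<rho> (space seq_space - B) X \<partial>?P) \<le> ennreal ?a * 1"
  proof (rule order_trans[OF I_le])
    show "AE f in Q. f \<in> space seq_space - B \<longrightarrow>
      - (\<rho> * (1 - \<rho>)) / 2 * (real n * (\<Sum>k. (f (Suc k) - f0 (Suc k))\<^sup>2)) \<le> ln ?a"
      using decay
    proof eventually_elim
      case (elim f)
      show ?case
      proof
        assume f: "f \<in> space seq_space - B"
        have d: "poly_decay b (\<lambda>k. f k - f0 k)" by (rule poly_decay_diff[OF elim f0])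
        \<comment> \<open>A sequence can miss \<open>l2_cball\<close> by failing square summability;
          decay rules this out, so the distance must exceed \<open>e\<close>.\<close>
        have "l2_seq (\<lambda>k. f k - f0 k)"
          unfolding l2_seq_def using poly_decay_summable_mult[OF b d d] by (simp add: power2_eq_square)
        with f have "l2_norm (\<lambda>k. f k - f0 k) > e" by (auto simp: B_def l2_cball_def)
        hence "e\<^sup>2 \<le> (l2_norm (\<lambda>k. f k - f0 k))\<^sup>2" using e by (intro power_mono) auto
        also have "\<dots> = (\<Sum>k. (f (Suc k) - f0 (Suc k))\<^sup>2)"
          unfolding l2_norm_def using sq0[OF elim] by simp
        finally have "\<rho> * (1 - \<rho>) / 2 * (real n * e\<^sup>2) \<le> \<rho> * (1 - \<rho>) / 2 * (real n * (\<Sum>k. (f (Suc k) - f0 (Suc k))\<^sup>2))"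
          using c\<rho> by (intro mult_left_mono) auto
        thus "- (\<rho> * (1 - \<rho>)) / 2 * (real n * (\<Sum>k. (f (Suc k) - f0 (Suc k))\<^sup>2)) \<le> ln ?a" by simp
      qed
    qed
    show "ennreal ?a * emeasure Q (space seq_space - B) \<le> ennreal ?a * 1"
      by (intro mult_left_mono Q.measure_le_1) auto
    show "space seq_space - B \<in> sets seq_space" by (intro sets.compl_sets B)
  qed auto
  have V_le: "(\<integral>\<^sup>+X. ?I (- \<rho>) K X \<partial>?P) \<le> ennreal ?b * emeasure Q K"
  proof (rule I_le)
    show "AE f in Q. f \<in> K \<longrightarrow>
      - ((- \<rho>) * (1 - (- \<rho>))) / 2 * (real n * (\<Sum>k. (f (Suc k) - f0 (Suc k))\<^sup>2)) \<le> ln ?b"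
    proof (intro AE_I2 impI)
      fix f assume "f \<in> K"
      have "\<rho> * (1 + \<rho>) / 2 * (real n * (\<Sum>k. (f (Suc k) - f0 (Suc k))\<^sup>2)) \<le> \<rho> * (1 + \<rho>) / 2 * \<kappa>"
        using \<rho> by (intro mult_left_mono K_dist \<open>f \<in> K\<close>) auto
      thus "- ((- \<rho>) * (1 - (- \<rho>))) / 2 * (real n * (\<Sum>k. (f (Suc k) - f0 (Suc k))\<^sup>2)) \<le> ln ?b" by simp
    qed
  qed (use K in auto)
  have "ennreal (1 - E) = (\<integral>\<^sup>+X. ennreal (1 - R X) \<partial>?P)"
  proof -
    have "(\<integral>\<^sup>+X. ennreal (1 - R X) \<partial>?P) = ennreal (LINT X|?P. 1 - R X)"
      using intR R1 by (intro nn_integral_eq_integral) auto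
    also have "(LINT X|?P. 1 - R X) = 1 - E"
      unfolding ER using intR by (simp add: P.prob_space)
    finally show ?thesis ..
  qed
  also have "\<dots> \<le> (\<integral>\<^sup>+X. ennreal \<tau> * ?I \<rho> (space seq_space - B) X
        + ennreal (1 / (\<tau> * (measure Q K)\<^sup>2)) * ?I (- \<rho>) K X \<partial>?P)"
    using AE_R by (intro nn_integral_mono_AE, eventually_elim) blast
  also have "\<dots> = ennreal \<tau> * (\<integral>\<^sup>+X. ?I \<rho> (space seq_space - B) X \<partial>?P)
        + ennreal (1 / (\<tau> * (measure Q K)\<^sup>2)) * (\<integral>\<^sup>+X. ?I (- \<rho>) K X \<partial>?P)"
    using I_meas[of "space seq_space - B" \<rho>] I_meas[OF K', of "- \<rho>"] B
    by (subst nn_integral_add) (auto simp: nn_integral_cmult)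
  also have "\<dots> \<le> ennreal \<tau> * (ennreal ?a * 1) + ennreal (1 / (\<tau> * (measure Q K)\<^sup>2)) * (ennreal ?b * emeasure Q K)"
    by (intro add_mono mult_left_mono N_le V_le) auto
  also have "\<dots> = ennreal (\<tau> * ?a + 1 / (\<tau> * (measure Q K)\<^sup>2) * (?b * measure Q K))"
    using \<tau> K0 by (simp add: Q.emeasure_eq_measure ennreal_mult'[symmetric] ennreal_plus[symmetric] del: ennreal_plus)
  also have "1 / (\<tau> * (measure Q K)\<^sup>2) * (?b * measure Q K) = ?b / (\<tau> * measure Q K)"
    using K0 by (simp add: power2_eq_square)
  finally show "1 - E \<le> \<tau> * ?a + ?b / (\<tau> * measure Q K)"
    using \<tau> K0 by (subst (asm) ennreal_le_iff) (auto intro!: add_nonneg_nonneg)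
qed

section \<open>Asymptotics\<close>

text \<open>Beyond \<open>k0\<close> a power with positive exponent that is at least 8 forces a base
  above 1; finitely many positive values remain.\<close>

lemma ratio_seq_lower_bound:
  assumes \<sigma>: "\<And>k. k \<ge> 1 \<Longrightarrow> \<sigma> k > 0" and p: "\<And>k. k \<ge> 1 \<Longrightarrow> p k > 0"
    and r: "\<And>k. k > k0 \<Longrightarrow> ratio_seq \<beta> \<sigma> k powr p k \<ge> 8"
  obtains r0 where "0 < r0" "r0 \<le> 1" "\<And>k. k \<ge> 1 \<Longrightarrow> r0 \<le> ratio_seq \<beta> \<sigma> k"
proof
  define A where "A = insert 1 (ratio_seq \<beta> \<sigma> ` {1..k0})"
  have A: "finite A" "A \<noteq> {}" by (auto simp: A_def)
  show "0 < Min A" using A \<sigma> by (subst Min_gr_iff) (auto simp: A_def intro!: ratio_seq_pos)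
  show m1: "Min A \<le> 1" using A by (intro Min_le) (auto simp: A_def)
  show "Min A \<le> ratio_seq \<beta> \<sigma> k" if k: "k \<ge> 1" for k
  proof (cases "k \<le> k0")
    case True
    thus ?thesis using k A by (intro Min_le) (auto simp: A_def)
  next
    case False
    have "ratio_seq \<beta> \<sigma> k > 1"
    proof (rule ccontr)
      assume "\<not> ratio_seq \<beta> \<sigma> k > 1"
      moreover have "ratio_seq \<beta> \<sigma> k > 0" by (rule ratio_seq_pos) (use k \<sigma> in auto)
      ultimately have "ratio_seq \<beta> \<sigma> k powr p k \<le> 1"
        using powr_mono2[of "p k" "ratio_seq \<beta> \<sigma> k" 1] p[OF k] by simp
      with r[of k] False show False by simp
    qed
    with m1 show ?thesis by simp
  qed
qed

text \<open>Rounding down a number that is at least 1 loses at most a factor 2. The last bound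
  raises \<open>n powr a \<le> 2 * N\<close> to the power \<open>2 * \<beta> + 1\<close>; it shows
  that \<open>n\<close> times the squared radius of the box is of order \<open>N\<close>.\<close>

lemma cutoff_bounds:
  assumes b: "\<beta> > 0" and n: "n \<ge> 1"
  defines "a \<equiv> 1 / (2 * \<beta> + 1)"
  shows "cutoff \<beta> n \<ge> 1" "real (cutoff \<beta> n) \<le> real n powr a" "real n powr a \<le> 2 * real (cutoff \<beta> n)"
    "real (cutoff \<beta> n) \<le> real n"
    "real n * real (cutoff \<beta> n) powr (-2 * \<beta>) \<le> 2 powr (2 * \<beta> + 1) * real (cutoff \<beta> n)"
proof -
  define x where "x = real n powr a"
  define N where "N = cutoff \<beta> n"
  have a: "0 < a" "a \<le> 1" using b by (auto simp: a_def)
  have x1: "x \<ge> 1" unfolding x_def using n a by (intro ge_one_powr_ge_zero) auto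
  have N: "real N = of_int \<lfloor>x\<rfloor>" unfolding N_def cutoff_def x_def a_def[symmetric]
    using x1 unfolding x_def by (simp add: le_floor_iff)
  show *: "cutoff \<beta> n \<ge> 1" using N x1 unfolding N_def by linarith
  show **: "real (cutoff \<beta> n) \<le> real n powr a" using N unfolding N_def x_def by linarith
  show ***: "real n powr a \<le> 2 * real (cutoff \<beta> n)" using N * unfolding N_def x_def by linarith
  have "real n powr a \<le> real n powr 1" using a n by (intro powr_mono) auto
  with ** show "real (cutoff \<beta> n) \<le> real n" using n by simp
  have "real n = (real n powr a) powr (2 * \<beta> + 1)" using b n by (simp add: powr_powr a_def)
  also have "\<dots> \<le> (2 * real N) powr (2 * \<beta> + 1)"
    using *** b unfolding N_def by (intro powr_mono2) auto
  also have "\<dots> = 2 powr (2 * \<beta> + 1) * real N powr (2 * \<beta> + 1)" by (simp add: powr_mult)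
  finally have "real n * real N powr (-2 * \<beta>) \<le> 2 powr (2 * \<beta> + 1) * real N powr (2 * \<beta> + 1) * real N powr (-2 * \<beta>)"
    by (intro mult_right_mono) auto
  also have "\<dots> = 2 powr (2 * \<beta> + 1) * real N"
    using * unfolding N_def by (simp add: mult.assoc powr_add[symmetric])
  finally show "real n * real (cutoff \<beta> n) powr (-2 * \<beta>) \<le> 2 powr (2 * \<beta> + 1) * real (cutoff \<beta> n)"
    unfolding N_def .
qed

theorem theorem3:
  fixes \<beta> L \<eta> \<rho> :: real and f0 \<sigma> p :: "nat \<Rightarrow> real"
  assumes "\<beta> > 0" and "L \<ge> 1" and "f0 \<in> hyperrectangle \<beta> L"
    and "\<And>k. k \<ge> 1 \<Longrightarrow> \<sigma> k > 0"
    and "\<And>k. k \<ge> 1 \<Longrightarrow> 0 < p k \<and> p k \<le> 1"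
    and "\<forall>\<^sub>F n in sequentially. \<forall>k > cutoff \<beta> n. ratio_seq \<beta> \<sigma> k powr p k \<ge> 8"
    and "\<eta> > 1"
    and "summable (\<lambda>k. exp (- z_seq \<beta> \<sigma> p (Suc k) / 4))"
    and "(\<lambda>n. \<Sum>k = 1..cutoff \<beta> n. z_seq \<beta> \<sigma> p k)
           \<in> O(\<lambda>n. real (cutoff \<beta> n) * ln (real n) powr \<eta>)"
    and "0 < \<rho>" and "\<rho> < 1"
  shows "\<exists>\<eta>' > 2 * \<eta>.
    (\<lambda>n. LINT X|gauss_seq_model n f0.
        rho_posterior \<rho> n (exp_power_prior \<sigma> p) X
          (l2_cball f0 (real n powr (- \<beta> / (2 * \<beta> + 1)) * ln (real n) powr \<eta>')))
      \<longlonglongrightarrow> 1"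
proof -
  note b = assms(1) and L = assms(2) and f0 = assms(3) and \<sigma> = assms(4) and p = assms(5)
    and ev8 = assms(6) and \<eta> = assms(7) and sm = assms(8) and bigO = assms(9) and \<rho>0 = assms(10) and \<rho>1 = assms(11)
  define Q where "Q = exp_power_prior \<sigma> p"
  define N where "N = cutoff \<beta>"
  define l where "l n = ln (real n) powr \<eta>" for n :: nat
  define a where "a = 1 / (2 * \<beta> + 1)"
  define \<eta>' where "\<eta>' = 2 * \<eta> + 1"
  define e where "e n = real n powr (- \<beta> / (2 * \<beta> + 1)) * ln (real n) powr \<eta>'" for n :: nat
  define E where "E n = (LINT X|gauss_seq_model n f0. rho_posterior \<rho> n Q X (l2_cball f0 (e n)))" for n
  have a: "0 < a" using b by (simp add: a_def)
  \<comment> \<open>One good \<open>n0\<close> suffices: it bounds the ratios beyond a frequency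
    that does not move with \<open>n\<close>, as Borel-Cantelli and the lower bound
    \<open>r0\<close> require.\<close>
  obtain n0 where n0: "\<And>k. k > cutoff \<beta> n0 \<Longrightarrow> ratio_seq \<beta> \<sigma> k powr p k \<ge> 8"
    using eventually_happens[OF ev8] by auto
  obtain r0 where r0: "0 < r0" "r0 \<le> 1" "\<And>k. k \<ge> 1 \<Longrightarrow> r0 \<le> ratio_seq \<beta> \<sigma> k"
    using ratio_seq_lower_bound[of \<sigma> p "cutoff \<beta> n0" \<beta>, OF \<sigma> _ n0] p by metis
  obtain Cz where Cz: "Cz > 0"
    "\<forall>\<^sub>F n in sequentially. norm (\<Sum>k = 1..cutoff \<beta> n. z_seq \<beta> \<sigma> p k) \<le> Cz * norm (real (cutoff \<beta> n) * ln (real n) powr \<eta>)"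
    using landau_o.bigE[OF bigO] by blast
  define Sz where "Sz = (\<Sum>k. exp (- z_seq \<beta> \<sigma> p (Suc k) / 4))"
  have Sz: "Sz \<ge> 0" unfolding Sz_def by (intro suminf_nonneg sm) auto
  \<comment> \<open>Costs are measured in units of \<open>M = N n * l n\<close>:
    \<open>exp (- C1 * M)\<close> will bound the prior mass of the box from below, and
    \<open>d * M\<close> the exponent of the moment on it. The gain outside the ball is
    \<open>c\<close> times \<open>n * (e n)\<^sup>2\<close>, which \<open>large\<close> makes at
    least \<open>(C1 + d + 2) * M\<close>.\<close>
  define C1 where "C1 = 2 - ln r0 + \<beta> + 1/2 + (L + 1) * Cz + 6 * Sz"
  define C2 where "C2 = (1 + (1 + L)\<^sup>2 / (2 * \<beta>)) * 2 powr (2 * \<beta> + 1)"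
  define c where "c = \<rho> * (1 - \<rho>) / 2"
  define d where "d = \<rho> * (1 + \<rho>) / 2 * C2"
  have C2: "C2 \<ge> 0" unfolding C2_def using b by (intro mult_nonneg_nonneg add_nonneg_nonneg) auto
  have c: "c > 0" and d: "d \<ge> 0" unfolding c_def d_def using \<rho>0 \<rho>1 C2 by auto
  have lnr0: "ln r0 \<le> 0" using r0 by simp
  interpret Q: prob_space Q unfolding Q_def using p by (intro prob_space_exp_power_prior) auto
  have decayQ: "AE f in Q. poly_decay \<beta> f"
    unfolding Q_def by (rule AE_exp_power_prior_poly_decay[OF \<sigma> p n0 sm])
  have large: "\<forall>\<^sub>F n in sequentially. c * ln (real n) powr (2 * \<eta>' - \<eta>) \<ge> C1 + d + 2"
  proof -
    have "2 * \<eta>' - \<eta> > 0" using \<eta> by (simp add: \<eta>'_def)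
    hence "filterlim (\<lambda>n. c * ln (real n) powr (2 * \<eta>' - \<eta>)) at_top sequentially"
      using c by real_asymp
    thus ?thesis by (simp add: filterlim_at_top)
  qed
  have main: "\<forall>\<^sub>F n in sequentially. E n \<le> 1 \<and> 1 - 2 * exp (- (real n powr a / 2)) \<le> E n"
    using Cz(2) ev8 large eventually_ge_at_top[of 3]
  proof eventually_elim
    case (elim n)
    have n: "n \<ge> 1" "real n \<ge> 3" using elim(4) by auto
    define M where "M = real (N n) * l n"
    define K where "K = sieve_box \<beta> f0 (N n)"
    note cut = cutoff_bounds[OF b n(1), folded N_def a_def]
    \<comment> \<open>The reason for \<open>n \<ge> 3\<close>: from \<open>ln n \<ge> 1\<close> on,
      \<open>ln n\<close> is at most \<open>ln n powr \<eta>\<close>, so the cost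
      \<open>ln N\<close> per frequency is absorbed into \<open>l n\<close>.\<close>
    have ln1: "ln (real n) \<ge> 1"
    proof -
      have "exp 1 \<le> real n" using exp_le n by linarith
      thus ?thesis using n by (subst ln_ge_iff) auto
    qed
    have l1: "l n \<ge> 1" unfolding l_def using ln1 \<eta> by (intro ge_one_powr_ge_zero) auto
    have "ln (real (N n)) \<le> ln (real n)" using cut n by simp
    also have "ln (real n) powr 1 \<le> ln (real n) powr \<eta>" using ln1 \<eta> by (intro powr_mono) auto
    hence "ln (real n) \<le> l n" unfolding l_def using ln1 by simp
    finally have lnN: "ln (real (N n)) \<le> l n" .
    have NM: "real (N n) \<le> M" unfolding M_def using l1 cut(1) by (simp add: mult_le_cancel_left1)
    have N0: "real (N n) \<ge> 1" using cut(1) by simp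
    have M1: "M \<ge> 1" using NM N0 by linarith
    have z: "(\<Sum>k=1..N n. z_seq \<beta> \<sigma> p k) \<le> Cz * M"
      using elim(1) l1 unfolding N_def[symmetric] l_def[symmetric] M_def by (simp add: abs_le_iff)
    have "real (N n) * (2 - ln r0 + (\<beta> + 1/2) * ln (real (N n))) + (L + 1) * (\<Sum>k=1..N n. z_seq \<beta> \<sigma> p k) + 6 * Sz
        \<le> (2 - ln r0 + \<beta> + 1/2) * M + (L + 1) * (Cz * M) + 6 * Sz * M"
    proof (intro add_mono)
      have "2 - ln r0 + (\<beta> + 1/2) * ln (real (N n)) \<le> (2 - ln r0) * l n + (\<beta> + 1/2) * l n"
        using lnN l1 lnr0 b by (intro add_mono mult_left_mono) (auto simp: mult_le_cancel_left1)
      hence "real (N n) * (2 - ln r0 + (\<beta> + 1/2) * ln (real (N n))) \<le> real (N n) * ((2 - ln r0) * l n + (\<beta> + 1/2) * l n)"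
        by (intro mult_left_mono) auto
      thus "real (N n) * (2 - ln r0 + (\<beta> + 1/2) * ln (real (N n))) \<le> (2 - ln r0 + \<beta> + 1/2) * M"
        by (simp add: M_def algebra_simps)
      show "(L + 1) * (\<Sum>k=1..N n. z_seq \<beta> \<sigma> p k) \<le> (L + 1) * (Cz * M)"
        using L z by (intro mult_left_mono) auto
      show "6 * Sz \<le> 6 * Sz * M" using Sz M1 by (simp add: mult_le_cancel_left1)
    qed
    also have "\<dots> = C1 * M" by (simp add: C1_def algebra_simps)
    finally have "exp (- (C1 * M)) \<le> exp (- (real (N n) * (2 - ln r0 + (\<beta> + 1/2) * ln (real (N n)))
        + (L + 1) * (\<Sum>k=1..N n. z_seq \<beta> \<sigma> p k) + 6 * Sz))" by simp
    also have "\<dots> \<le> measure Q K"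
      unfolding Q_def K_def Sz_def using L elim(2) cut(1)
      by (intro measure_sieve_box_ge b f0 \<sigma> p r0 sm) (auto simp: N_def)
    finally have mass: "exp (- (C1 * M)) \<le> measure Q K" .
    have mass0: "measure Q K > 0" using mass exp_gt_zero[of "- (C1 * M)"] by linarith
    have dist: "real n * (\<Sum>k. (f (Suc k) - f0 (Suc k))\<^sup>2) \<le> C2 * real (N n)" if "f \<in> K" for f
    proof -
      have "(\<Sum>k. (f (Suc k) - f0 (Suc k))\<^sup>2) \<le> (1 + (1 + L)\<^sup>2 / (2 * \<beta>)) * real (N n) powr (-2 * \<beta>)"
        using that cut(1) unfolding K_def by (intro sieve_box_dist_le b f0)
      hence "real n * (\<Sum>k. (f (Suc k) - f0 (Suc k))\<^sup>2)
          \<le> real n * ((1 + (1 + L)\<^sup>2 / (2 * \<beta>)) * real (N n) powr (-2 * \<beta>))"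
        by (intro mult_left_mono) auto
      also have "\<dots> = (1 + (1 + L)\<^sup>2 / (2 * \<beta>)) * (real n * real (N n) powr (-2 * \<beta>))" by simp
      also have "\<dots> \<le> (1 + (1 + L)\<^sup>2 / (2 * \<beta>)) * (2 powr (2 * \<beta> + 1) * real (N n))"
        using cut(5) b by (intro mult_left_mono add_nonneg_nonneg) auto
      finally show ?thesis by (simp add: C2_def)
    qed
    have ne: "real n * (e n)\<^sup>2 \<ge> M * ln (real n) powr (2 * \<eta>' - \<eta>)"
    proof -
      have psq: "(x powr t)\<^sup>2 = x powr (2 * t)" for x t :: real
        by (simp add: power2_eq_square powr_add[symmetric])
      have "(e n)\<^sup>2 = real n powr (- (2 * \<beta>) / (2 * \<beta> + 1)) * ln (real n) powr (2 * \<eta>')"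
        unfolding e_def power_mult_distrib psq by simp
      moreover have "real n * real n powr (- (2 * \<beta>) / (2 * \<beta> + 1)) = real n powr a"
      proof -
        have "1 + - (2 * \<beta>) / (2 * \<beta> + 1) = a" using b by (simp add: a_def field_simps)
        thus ?thesis using n powr_add[of "real n" 1 "- (2 * \<beta>) / (2 * \<beta> + 1)"] by simp
      qed
      ultimately have "real n * (e n)\<^sup>2 = real n powr a * ln (real n) powr (2 * \<eta>')"
        by (simp flip: mult.assoc)
      also have "ln (real n) powr (2 * \<eta>') = l n * ln (real n) powr (2 * \<eta>' - \<eta>)"
        by (simp add: l_def powr_add[symmetric])
      also have "real n powr a * (l n * ln (real n) powr (2 * \<eta>' - \<eta>)) \<ge> real (N n) * (l n * ln (real n) powr (2 * \<eta>' - \<eta>))"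
        using cut(2) l1 by (intro mult_right_mono) auto
      finally show ?thesis by (simp add: M_def mult.assoc)
    qed
    \<comment> \<open>Balances the two error terms: the first becomes at most
      \<open>exp (- M)\<close> by \<open>large\<close>, and the second has exponent
      \<open>d * M - (C1 + d + 1) * M + C1 * M = - M\<close>.\<close>
    define \<tau> where "\<tau> = exp ((C1 + d + 1) * M)"
    have \<tau>0: "\<tau> > 0" and e0: "e n \<ge> 0" by (simp_all add: \<tau>_def e_def)
    have sQ: "sets Q = sets seq_space" by (simp only: Q_def sets_exp_power_prior)
    have K_sets: "K \<in> sets seq_space" unfolding K_def by (rule sets_seq_box)
    have K_decay: "poly_decay \<beta> f" if "f \<in> K" for f
      using that unfolding K_def by (rule sieve_box_poly_decay)
    have *: "E n \<le> 1" "1 - E n \<le> \<tau> * exp (- (\<rho> * (1 - \<rho>)) / 2 * (real n * (e n)\<^sup>2))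
        + exp (\<rho> * (1 + \<rho>) / 2 * (C2 * real (N n))) / (\<tau> * measure Q K)"
      unfolding E_def by (rule expectation_rho_posterior_ge[OF Q.prob_space_axioms sQ decayQ b
          hyperrectangle_poly_decay[OF f0] n(1) \<rho>0 \<rho>1 e0 \<tau>0 K_sets mass0 K_decay dist]; assumption)+
    have "\<tau> * exp (- (\<rho> * (1 - \<rho>)) / 2 * (real n * (e n)\<^sup>2)) = exp ((C1 + d + 1) * M - c * (real n * (e n)\<^sup>2))"
      by (simp add: \<tau>_def c_def flip: exp_add)
    also have "\<dots> \<le> exp (- M)"
    proof -
      have "M * (C1 + d + 2) \<le> M * (c * ln (real n) powr (2 * \<eta>' - \<eta>))"
        using elim(3) M1 by (intro mult_left_mono) auto
      also have "\<dots> = c * (M * ln (real n) powr (2 * \<eta>' - \<eta>))" by simp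
      also have "\<dots> \<le> c * (real n * (e n)\<^sup>2)" using ne c by (intro mult_left_mono) auto
      finally show ?thesis by (simp add: algebra_simps)
    qed
    finally have t1: "\<tau> * exp (- (\<rho> * (1 - \<rho>)) / 2 * (real n * (e n)\<^sup>2)) \<le> exp (- M)" .
    have "exp (\<rho> * (1 + \<rho>) / 2 * (C2 * real (N n))) / (\<tau> * measure Q K)
        \<le> exp (d * M) / (\<tau> * exp (- (C1 * M)))"
    proof (intro frac_le mult_left_mono mass)
      have "d * real (N n) \<le> d * M" using d NM by (intro mult_left_mono)
      thus "exp (\<rho> * (1 + \<rho>) / 2 * (C2 * real (N n))) \<le> exp (d * M)" by (simp add: d_def mult.assoc)
    qed (auto simp: \<tau>_def)
    also have "\<dots> = exp (- M)"
      by (simp add: \<tau>_def exp_diff[symmetric] algebra_simps flip: exp_add)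
    finally have t2: "exp (\<rho> * (1 + \<rho>) / 2 * (C2 * real (N n))) / (\<tau> * measure Q K) \<le> exp (- M)" .
    \<comment> \<open>Replaces \<open>M\<close>, which contains a floor, by an explicit divergent
      lower bound.\<close>
    have "real n powr a / 2 \<le> M" using cut(3) NM by linarith
    hence "exp (- M) \<le> exp (- (real n powr a / 2))" by simp
    with * t1 t2 show ?case by linarith
  qed
  have "(\<lambda>n. 1 - 2 * exp (- (real n powr a / 2))) \<longlonglongrightarrow> 1"
    using a by real_asymp
  hence "E \<longlonglongrightarrow> 1"
    using main by (intro tendsto_sandwich[of "\<lambda>n. 1 - 2 * exp (- (real n powr a / 2))" E sequentially "\<lambda>_. 1"])
      (auto elim!: eventually_mono)
  moreover have "\<eta>' > 2 * \<eta>" by (simp add: \<eta>'_def)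
  ultimately show ?thesis unfolding E_def e_def Q_def by blast
qed

end
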